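(* Let $(e_i)_{i\in\mathbb{N}}$ and $(e_i')_{i\in\mathbb{N}}$ be the unit vector basis of $\ell_1$ and its sequence of coordinate functionals, respectively. Given $\alpha>0$, define $$x_{i}:=e_i+ 2(\alpha+1)(-1)^{i}e_1\ \ (i\ge 2),\qquad X:=\overline{[x_{i}: i\ge 2]},\qquad x_{i}':=e_i'\big|_{X}\ \ (i\ge 2).$$ The following statements hold: (a) $(x_i)_{i\ge 2}$ is a basic sequence equivalent to the unit vector basis of $\ell_1$, with democracy constant $K_{d}> \alpha+1$. (b) $(x_i)_{i\ge 2}$ is an almost greedy Markushevich basis for $X$ with biorthogonal functionals $(x_i')_{i\ge 2}$. Its almost greedy constant and its (first and second) quasi-greedy constants are greater than $\alpha$. (c) For every $0<\tau<1$, if $M(\tau)$ is a WAG($\tau$) constant for $(x_i)_{i\ge 2}$, then $M(\tau) > \tau \sqrt{\alpha+1}$. (d) $(x_i)_{i\ge 2}$ is a semi-greedy Markushevich basis for $X$ with semi-greedy constant $K_{s}\le 4$. Moreover, for every $0<\tau\le1$, every $x\in X$, every $m\in \mathbb{N}$ and every $m$-weak thresholding set $\mathcal{W}^{\tau}(x,m)$ for $x$ with weakness parameter $\tau$, there are scalars $(b_i)_{i\in \mathcal{W}^{\tau}(x,m)}$ such that $$\Big\|x-\sum_{i\in \mathcal{W}^{\tau}(x,m)}b_ix_i\Big\|\le 4\tau^{-1}\sigma_{m}(x).$$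
   Context: The scalar field is $\mathbb{R}$ or $\mathbb{C}$; all index sets below are $\{i\in\mathbb{N}:i\ge2\}$ and $[\,\cdot\,]$ denotes linear span. A Markushevich basis for $X$ is a system $(x_i)_i$ with $X=\overline{[x_i]}$ and biorthogonal functionals $(x_i')_i\subseteq X'$ ($x_i'(x_j)=\delta_{ij}$) that are total. $\mathrm{supp}(x)=\{i:x_i'(x)\ne0\}$; for finite $A$, $P_A(x)=\sum_{i\in A}x_i'(x)x_i$; $\sigma_m(x)=\inf\{\|x-y\|: |\mathrm{supp}(y)|\le m,\ y=P_{\mathrm{supp}(y)}(y)\}$ and $\widetilde\sigma_m(x)=\inf\{\|x-P_A(x)\|:|A|\le m\}$. The greedy ordering $\rho(x,\cdot)$ is the injective map from $\mathbb{N}$ to the index set whose range contains $\mathrm{supp}(x)$, with $|x'_{\rho(x,i)}(x)|\ge|x'_{\rho(x,j)}(x)|$ for $i\le j$, ties broken so that $i<j$ and $|x'_{\rho(x,i)}(x)|=|x'_{\rho(x,j)}(x)|$ imply $\rho(x,i)<\rho(x,j)$. $\mathcal{GS}_m(x)=\{\rho(x,i):1\le i\le m\}$, $\mathcal{G}_m(x)=P_{\mathcal{GS}_m(x)}(x)$, $\mathcal{G}_0(x)=0$. First (resp. second) quasi-greedy constant: the minimum $M$ with $\|\mathcal{G}_m(x)\|\le M\|x\|$ (resp. $\|x-\mathcal{G}_m(x)\|\le M\|x\|$) for all $x,m$. Almost greedy: $(x_i')_i$ bounded and there is $M$ with $\|x-\mathcal{G}_m(x)\|\le M\widetilde\sigma_m(x)$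 for all $x$, $m\in\mathbb{N}_0$; the minimum $M$ is the almost greedy constant. Democracy constant: the minimum $K$ with $\|\sum_{i\in A}x_i\|\le K\|\sum_{j\in B}x_j\|$ for all finite $A,B$ with $|A|\le|B|$. Semi-greedy: $(x_i')_i$ bounded and there is $M>0$ such that for every $x$ and $m\in\mathbb{N}$ there is $z\in[x_i:i\in\mathcal{GS}_m(x)]$ with $\|x-z\|\le M\sigma_m(x)$; the minimum $M$ is the semi-greedy constant. For $0<\tau\le1$, an $m$-weak thresholding set $\mathcal{W}^\tau(x,m)$ for $x$ with weakness parameter $\tau$ is a set of $m$ indices with $|x_i'(x)|\ge\tau|x_j'(x)|$ for all $i\in\mathcal{W}^\tau(x,m)$ and all indices $j\notin\mathcal{W}^\tau(x,m)$. The system is WAG($\tau$) with constant $M$ if for every $x$ and $m\in\mathbb{N}$ there is such a set with $\|x-P_{\mathcal{W}^\tau(x,m)}(x)\|\le M\widetilde\sigma_m(x)$. *)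

theory Defs
  imports "HOL-Analysis.Analysis"
begin

section \<open>Bases and the greedy algorithm in normed spaces over a scalar field\<close>

text \<open>
  The class \<^class>\<open>real_normed_vector\<close> only provides real scalars, so the scalar multiplication
  over the field \<open>'k\<close> is a locale parameter. The vector space is the whole type \<open>'v\<close>; the space
  \<open>X\<close> in the definitions below is a subspace of it, and functionals on \<open>X\<close> are functions
  \<open>'v \<Rightarrow> 'k\<close> of which only the values on \<open>X\<close> matter.

  Types of sort \<open>{real_normed_field, euclidean_space}\<close> serve as the scalar fields: \<^typ>\<open>real\<close> and
  \<^typ>\<open>complex\<close> are instances, and by the Gelfand--Mazur theorem every instance is isometrically
  isomorphic to one of them.
\<close>

text \<open>
  Constants such as ``the minimum \<open>M\<close> with \<open>P M\<close>'' are predicates below: the minimum need not exist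
  for every system.
\<close>

definition is_minimum :: "(real \<Rightarrow> bool) \<Rightarrow> real \<Rightarrow> bool" where
  "is_minimum P M \<longleftrightarrow> P M \<and> (\<forall>N. P N \<longrightarrow> M \<le> N)"

locale normed_space = vector_space scale
  for scale :: "'k::real_normed_field \<Rightarrow> 'v::real_normed_vector \<Rightarrow> 'v" +
  assumes norm_scale: "norm (scale c v) = norm c * norm v"
begin

subsection \<open>Basic sequences and equivalence\<close>

text \<open>
  A basic sequence is a Schauder basis of its closed linear span; basic sequences \<open>y\<close> and \<open>z\<close> are
  equivalent if the series with coefficients \<open>a\<close> converge for exactly the same \<open>a\<close>.
\<close>

definition basic_sequence :: "(nat \<Rightarrow> 'v) \<Rightarrow> bool" where
  "basic_sequence y \<longleftrightarrow>
     (\<forall>v \<in> closure (span (range y)). \<exists>!a. (\<lambda>k. scale (a k) (y k)) sums v)"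

definition equivalent_sequences :: "(nat \<Rightarrow> 'v) \<Rightarrow> (nat \<Rightarrow> 'v) \<Rightarrow> bool" where
  "equivalent_sequences y z \<longleftrightarrow>
     (\<forall>a. summable (\<lambda>k. scale (a k) (y k)) \<longleftrightarrow> summable (\<lambda>k. scale (a k) (z k)))"

subsection \<open>Markushevich bases indexed by \<open>{2..}\<close>\<close>

definition bounded_functional_on :: "'v set \<Rightarrow> ('v \<Rightarrow> 'k) \<Rightarrow> bool" where
  "bounded_functional_on X f \<longleftrightarrow>
     (\<forall>u\<in>X. \<forall>v\<in>X. f (u + v) = f u + f v) \<and>
     (\<forall>c. \<forall>u\<in>X. f (scale c u) = c * f u) \<and>
     (\<exists>B. \<forall>u\<in>X. norm (f u) \<le> B * norm u)"

definition markushevich_basis ::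
  "'v set \<Rightarrow> (nat \<Rightarrow> 'v) \<Rightarrow> (nat \<Rightarrow> 'v \<Rightarrow> 'k) \<Rightarrow> bool" where
  "markushevich_basis X x x' \<longleftrightarrow>
     X = closure (span (x ` {2..})) \<and>
     (\<forall>i\<ge>2. bounded_functional_on X (x' i)) \<and>
     (\<forall>i\<ge>2. \<forall>j\<ge>2. x' i (x j) = (if i = j then 1 else 0)) \<and>
     (\<forall>v\<in>X. (\<forall>i\<ge>2. x' i v = 0) \<longrightarrow> v = 0)"

text \<open>Boundedness of the sequence \<open>x'\<close> in the dual norm of \<open>X\<close>.\<close>

definition bounded_functionals :: "'v set \<Rightarrow> (nat \<Rightarrow> 'v \<Rightarrow> 'k) \<Rightarrow> bool" where
  "bounded_functionals X x' \<longleftrightarrow> (\<exists>B. \<forall>i\<ge>2. \<forall>v\<in>X. norm (x' i v) \<le> B * norm v)"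

definition supp :: "(nat \<Rightarrow> 'v \<Rightarrow> 'k) \<Rightarrow> 'v \<Rightarrow> nat set" where
  "supp x' v = {i. 2 \<le> i \<and> x' i v \<noteq> 0}"

definition proj :: "(nat \<Rightarrow> 'v) \<Rightarrow> (nat \<Rightarrow> 'v \<Rightarrow> 'k) \<Rightarrow> nat set \<Rightarrow> 'v \<Rightarrow> 'v" where
  "proj x x' A v = (\<Sum>i\<in>A. scale (x' i v) (x i))"

definition sigma ::
  "'v set \<Rightarrow> (nat \<Rightarrow> 'v) \<Rightarrow> (nat \<Rightarrow> 'v \<Rightarrow> 'k) \<Rightarrow> nat \<Rightarrow> 'v \<Rightarrow> real" where
  "sigma X x x' m v =
     Inf {norm (v - y) | y. y \<in> X \<and> finite (supp x' y) \<and> card (supp x' y) \<le> m \<and>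
                            y = proj x x' (supp x' y) y}"

definition sigma_tilde ::
  "(nat \<Rightarrow> 'v) \<Rightarrow> (nat \<Rightarrow> 'v \<Rightarrow> 'k) \<Rightarrow> nat \<Rightarrow> 'v \<Rightarrow> real" where
  "sigma_tilde x x' m v =
     Inf {norm (v - proj x x' A v) | A. finite A \<and> A \<subseteq> {2..} \<and> card A \<le> m}"

subsection \<open>The greedy algorithm\<close>

definition is_greedy_ordering :: "(nat \<Rightarrow> 'v \<Rightarrow> 'k) \<Rightarrow> 'v \<Rightarrow> (nat \<Rightarrow> nat) \<Rightarrow> bool" where
  "is_greedy_ordering x' v \<rho> \<longleftrightarrow>
     inj_on \<rho> {1..} \<and> \<rho> ` {1..} \<subseteq> {2..} \<and> supp x' v \<subseteq> \<rho> ` {1..} \<and>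
     (\<forall>i\<ge>1. \<forall>j\<ge>i. norm (x' (\<rho> i) v) \<ge> norm (x' (\<rho> j) v)) \<and>
     (\<forall>i\<ge>1. \<forall>j>i. norm (x' (\<rho> i) v) = norm (x' (\<rho> j) v) \<longrightarrow> \<rho> i < \<rho> j)"

text \<open>
  The values of a greedy ordering on \<open>{1..}\<close> are determined by the conditions above, except that for
  finite support the positions after \<open>card (supp x' v)\<close> are not. There the coefficients vanish,
  so that the choice does not affect \<open>greedy_sum\<close>.
\<close>

definition greedy_ordering :: "(nat \<Rightarrow> 'v \<Rightarrow> 'k) \<Rightarrow> 'v \<Rightarrow> nat \<Rightarrow> nat" where
  "greedy_ordering x' v = (SOME \<rho>. is_greedy_ordering x' v \<rho>)"

definition greedy_set :: "(nat \<Rightarrow> 'v \<Rightarrow> 'k) \<Rightarrow> nat \<Rightarrow> 'v \<Rightarrow> nat set" where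
  "greedy_set x' m v = greedy_ordering x' v ` {1..m}"

definition greedy_sum ::
  "(nat \<Rightarrow> 'v) \<Rightarrow> (nat \<Rightarrow> 'v \<Rightarrow> 'k) \<Rightarrow> nat \<Rightarrow> 'v \<Rightarrow> 'v" where
  "greedy_sum x x' m v = proj x x' (greedy_set x' m v) v"

definition first_quasi_greedy_constant ::
  "'v set \<Rightarrow> (nat \<Rightarrow> 'v) \<Rightarrow> (nat \<Rightarrow> 'v \<Rightarrow> 'k) \<Rightarrow> real \<Rightarrow> bool" where
  "first_quasi_greedy_constant X x x' =
     is_minimum (\<lambda>M. \<forall>v\<in>X. \<forall>m\<ge>1. norm (greedy_sum x x' m v) \<le> M * norm v)"

definition second_quasi_greedy_constant ::
  "'v set \<Rightarrow> (nat \<Rightarrow> 'v) \<Rightarrow> (nat \<Rightarrow> 'v \<Rightarrow> 'k) \<Rightarrow> real \<Rightarrow> bool" where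
  "second_quasi_greedy_constant X x x' =
     is_minimum (\<lambda>M. \<forall>v\<in>X. \<forall>m\<ge>1. norm (v - greedy_sum x x' m v) \<le> M * norm v)"

definition almost_greedy_bound ::
  "'v set \<Rightarrow> (nat \<Rightarrow> 'v) \<Rightarrow> (nat \<Rightarrow> 'v \<Rightarrow> 'k) \<Rightarrow> real \<Rightarrow> bool" where
  "almost_greedy_bound X x x' M \<longleftrightarrow>
     (\<forall>v\<in>X. \<forall>m. norm (v - greedy_sum x x' m v) \<le> M * sigma_tilde x x' m v)"

definition almost_greedy ::
  "'v set \<Rightarrow> (nat \<Rightarrow> 'v) \<Rightarrow> (nat \<Rightarrow> 'v \<Rightarrow> 'k) \<Rightarrow> bool" where
  "almost_greedy X x x' \<longleftrightarrow>
     bounded_functionals X x' \<and> (\<exists>M. almost_greedy_bound X x x' M)"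

definition almost_greedy_constant ::
  "'v set \<Rightarrow> (nat \<Rightarrow> 'v) \<Rightarrow> (nat \<Rightarrow> 'v \<Rightarrow> 'k) \<Rightarrow> real \<Rightarrow> bool" where
  "almost_greedy_constant X x x' = is_minimum (almost_greedy_bound X x x')"

definition democracy_constant :: "(nat \<Rightarrow> 'v) \<Rightarrow> real \<Rightarrow> bool" where
  "democracy_constant x =
     is_minimum (\<lambda>K. \<forall>A B. finite A \<and> finite B \<and> A \<subseteq> {2..} \<and> B \<subseteq> {2..} \<and> card A \<le> card B \<longrightarrow>
                           norm (\<Sum>i\<in>A. x i) \<le> K * norm (\<Sum>j\<in>B. x j))"

definition semi_greedy_bound ::
  "'v set \<Rightarrow> (nat \<Rightarrow> 'v) \<Rightarrow> (nat \<Rightarrow> 'v \<Rightarrow> 'k) \<Rightarrow> real \<Rightarrow> bool" where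
  "semi_greedy_bound X x x' M \<longleftrightarrow>
     M > 0 \<and>
     (\<forall>v\<in>X. \<forall>m\<ge>1. \<exists>z \<in> span (x ` greedy_set x' m v). norm (v - z) \<le> M * sigma X x x' m v)"

definition semi_greedy ::
  "'v set \<Rightarrow> (nat \<Rightarrow> 'v) \<Rightarrow> (nat \<Rightarrow> 'v \<Rightarrow> 'k) \<Rightarrow> bool" where
  "semi_greedy X x x' \<longleftrightarrow>
     bounded_functionals X x' \<and> (\<exists>M. semi_greedy_bound X x x' M)"

definition semi_greedy_constant ::
  "'v set \<Rightarrow> (nat \<Rightarrow> 'v) \<Rightarrow> (nat \<Rightarrow> 'v \<Rightarrow> 'k) \<Rightarrow> real \<Rightarrow> bool" where
  "semi_greedy_constant X x x' = is_minimum (semi_greedy_bound X x x')"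

subsection \<open>Weak thresholding\<close>

definition weak_thresholding_set ::
  "(nat \<Rightarrow> 'v \<Rightarrow> 'k) \<Rightarrow> real \<Rightarrow> 'v \<Rightarrow> nat \<Rightarrow> nat set \<Rightarrow> bool" where
  "weak_thresholding_set x' \<tau> v m W \<longleftrightarrow>
     finite W \<and> W \<subseteq> {2..} \<and> card W = m \<and>
     (\<forall>i\<in>W. \<forall>j\<in>{2..} - W. norm (x' i v) \<ge> \<tau> * norm (x' j v))"

definition WAG ::
  "'v set \<Rightarrow> (nat \<Rightarrow> 'v) \<Rightarrow> (nat \<Rightarrow> 'v \<Rightarrow> 'k) \<Rightarrow> real \<Rightarrow> real \<Rightarrow> bool" where
  "WAG X x x' \<tau> M \<longleftrightarrow>
     (\<forall>v\<in>X. \<forall>m\<ge>1. \<exists>W. weak_thresholding_set x' \<tau> v m W \<and>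
                        norm (v - proj x x' W v) \<le> M * sigma_tilde x x' m v)"

end

section \<open>The space \<open>\<ell>\<^sub>1\<close>\<close>

text \<open>
  Sequences are indexed by \<open>1, 2, \<dots>\<close>; entry \<open>0\<close> of the underlying function is a dummy that is
  fixed to be zero.
\<close>

typedef (overloaded) 'k l1 =
  "{f :: nat \<Rightarrow> 'k::real_normed_vector. f 0 = 0 \<and> summable (\<lambda>i. norm (f i))}"
  morphisms coord Abs_l1
  by (rule exI[of _ "\<lambda>_. 0"]) simp

setup_lifting type_definition_l1

instantiation l1 :: (real_normed_vector) real_normed_vector
begin

lift_definition zero_l1 :: "'a l1" is "\<lambda>_. 0"
  by simp

lift_definition plus_l1 :: "'a l1 \<Rightarrow> 'a l1 \<Rightarrow> 'a l1" is "\<lambda>f g i. f i + g i"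
proof -
  fix f g :: "nat \<Rightarrow> 'a"
  assume f: "f 0 = 0 \<and> summable (\<lambda>i. norm (f i))"
    and g: "g 0 = 0 \<and> summable (\<lambda>i. norm (g i))"
  then have "summable (\<lambda>i. norm (f i) + norm (g i))"
    by (simp add: summable_add)
  then have "summable (\<lambda>i. norm (f i + g i))"
    by (rule summable_comparison_test'[where N = 0]) (simp add: norm_triangle_ineq)
  with f g show "f 0 + g 0 = 0 \<and> summable (\<lambda>i. norm (f i + g i))"
    by simp
qed

lift_definition uminus_l1 :: "'a l1 \<Rightarrow> 'a l1" is "\<lambda>f i. - f i"
  by simp

lift_definition minus_l1 :: "'a l1 \<Rightarrow> 'a l1 \<Rightarrow> 'a l1" is "\<lambda>f g i. f i - g i"
proof -
  fix f g :: "nat \<Rightarrow> 'a"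
  assume f: "f 0 = 0 \<and> summable (\<lambda>i. norm (f i))"
    and g: "g 0 = 0 \<and> summable (\<lambda>i. norm (g i))"
  then have "summable (\<lambda>i. norm (f i) + norm (g i))"
    by (simp add: summable_add)
  then have "summable (\<lambda>i. norm (f i - g i))"
    by (rule summable_comparison_test'[where N = 0]) (simp add: norm_triangle_ineq4)
  with f g show "f 0 - g 0 = 0 \<and> summable (\<lambda>i. norm (f i - g i))"
    by simp
qed

lift_definition scaleR_l1 :: "real \<Rightarrow> 'a l1 \<Rightarrow> 'a l1" is "\<lambda>r f i. r *\<^sub>R f i"
  by (simp add: summable_mult)

lift_definition norm_l1 :: "'a l1 \<Rightarrow> real" is "\<lambda>f. \<Sum>i. norm (f i)" .

definition "sgn (f :: 'a l1) = inverse (norm f) *\<^sub>R f"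
definition "dist (f :: 'a l1) g = norm (f - g)"
definition [code del]: "(uniformity :: ('a l1 \<times> 'a l1) filter) =
  (INF e\<in>{0 <..}. principal {(x, y). dist x y < e})"
definition [code del]: "open (U :: 'a l1 set) \<longleftrightarrow>
  (\<forall>x\<in>U. eventually (\<lambda>(x', y). x' = x \<longrightarrow> y \<in> U) uniformity)"

instance
proof
  fix f g h :: "'a l1" and a b :: real
  show "f + g + h = f + (g + h)" by transfer (simp add: add.assoc)
  show "f + g = g + f" by transfer (simp add: add.commute)
  show "0 + f = f" by transfer simp
  show "- f + f = 0" by transfer simp
  show "f - g = f + - g" by transfer simp
  show "a *\<^sub>R (f + g) = a *\<^sub>R f + a *\<^sub>R g" by transfer (simp add: scaleR_right_distrib)
  show "(a + b) *\<^sub>R f = a *\<^sub>R f + b *\<^sub>R f" by transfer (simp add: scaleR_left_distrib)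
  show "a *\<^sub>R b *\<^sub>R f = (a * b) *\<^sub>R f" by transfer simp
  show "1 *\<^sub>R f = f" by transfer simp
  show "dist f g = norm (f - g)" by (rule dist_l1_def)
  show "sgn f = inverse (norm f) *\<^sub>R f" by (rule sgn_l1_def)
  show "(uniformity :: ('a l1 \<times> 'a l1) filter) =
      (INF e\<in>{0 <..}. principal {(x, y). dist x y < e})"
    by (rule uniformity_l1_def)
  show "open U \<longleftrightarrow> (\<forall>x\<in>U. eventually (\<lambda>(x', y). x' = x \<longrightarrow> y \<in> U) uniformity)"
    for U :: "'a l1 set" by (rule open_l1_def)
  show "(norm f = 0) = (f = 0)"
    by transfer (auto simp: suminf_eq_zero_iff fun_eq_iff)
  show "norm (f + g) \<le> norm f + norm g"
  proof transfer
    fix f g :: "nat \<Rightarrow> 'a"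
    assume f: "f 0 = 0 \<and> summable (\<lambda>i. norm (f i))"
      and g: "g 0 = 0 \<and> summable (\<lambda>i. norm (g i))"
    have fg: "summable (\<lambda>i. norm (f i) + norm (g i))"
      using f g by (simp add: summable_add)
    then have "summable (\<lambda>i. norm (f i + g i))"
      by (rule summable_comparison_test'[where N = 0]) (simp add: norm_triangle_ineq)
    then have "(\<Sum>i. norm (f i + g i)) \<le> (\<Sum>i. norm (f i) + norm (g i))"
      using fg by (intro suminf_le) (simp_all add: norm_triangle_ineq)
    then show "(\<Sum>i. norm (f i + g i)) \<le> (\<Sum>i. norm (f i)) + (\<Sum>i. norm (g i))"
      using f g by (simp add: suminf_add)
  qed
  show "norm (a *\<^sub>R f) = \<bar>a\<bar> * norm f"
    by transfer (simp add: suminf_mult)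
qed

end

lift_definition l1_scale :: "'k::real_normed_field \<Rightarrow> 'k l1 \<Rightarrow> 'k l1" is "\<lambda>c f i. c * f i"
  by (simp add: norm_mult summable_mult)

global_interpretation l1: normed_space l1_scale
proof
  fix a b :: "'k::real_normed_field" and f g :: "'k l1"
  show "l1_scale a (f + g) = l1_scale a f + l1_scale a g"
    by transfer (simp add: distrib_left)
  show "l1_scale (a + b) f = l1_scale a f + l1_scale b f"
    by transfer (simp add: distrib_right)
  show "l1_scale a (l1_scale b f) = l1_scale (a * b) f"
    by transfer (simp add: mult.assoc)
  show "l1_scale 1 f = f"
    by transfer simp
  show "norm (l1_scale a f) = norm a * norm f"
    by transfer (simp add: norm_mult suminf_mult)
qed

text \<open>The unit vectors; only the indices \<open>i \<ge> 1\<close> are meaningful.\<close>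

lift_definition l1_unit :: "nat \<Rightarrow> 'k::real_normed_field l1" is
  "\<lambda>i j. if j = i \<and> 1 \<le> i then 1 else 0"
proof -
  fix n :: nat
  have "summable (\<lambda>i. norm (if i = n \<and> 1 \<le> n then 1 else 0 :: 'k))"
    by (rule summable_finite[of "{n}"]) auto
  then show "(if 0 = n \<and> 1 \<le> n then 1 else 0 :: 'k) = 0 \<and>
      summable (\<lambda>i. norm (if i = n \<and> 1 \<le> n then 1 else 0 :: 'k))"
    by auto
qed

definition l1_coord :: "nat \<Rightarrow> 'k::real_normed_field l1 \<Rightarrow> 'k" where
  "l1_coord i f = coord f i"

end

theory Submission
  imports Defs
begin

text \<open>
  Write \<open>c = 2 (\<alpha> + 1)\<close>. A vector of \<open>\<ell>\<^sub>1\<close> lies in \<open>X\<close> exactly when its first coordinate is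
  \<open>c\<close> times the alternating sum \<open>L v = \<Sum>\<^sub>i (-1)\<^sup>i v\<^sub>i\<close> (\<open>i \<ge> 2\<close>) of its other coordinates
  (\<open>X_eq_tilted_plane\<close>). Hence on \<open>X\<close> the norm is \<open>S v + c \<bar>L v\<bar>\<close>, where
  \<open>S v = \<Sum>\<^sub>i \<bar>v\<^sub>i\<bar>\<close>; as \<open>\<bar>L v\<bar> \<le> S v\<close>, it is equivalent to the \<open>\<ell>\<^sub>1\<close>-norm \<open>S\<close> with constant
  \<open>1 + c\<close>. This equivalence makes the system a basis equivalent to the unit vectors, and gives
  finite bounds for democracy, quasi-greediness and almost greediness.

  All lower bounds come from the single vector \<open>x\<^sub>2 + x\<^sub>3\<close>. The two tilts cancel, so its norm is
  \<open>2\<close>, whereas \<open>x\<^sub>2\<close> and \<open>x\<^sub>3\<close> have norm \<open>1 + c\<close>. A thresholding set with one element must pick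
  exactly one of them, whatever \<open>\<tau>\<close> is (\<open>thresholding_pair\<close>), so projecting onto it costs a
  factor \<open>(1 + c) / 2 = \<alpha> + 3/2\<close>.

  Changing the coefficients, rather than keeping those of \<open>v\<close>, removes this loss: a single index of
  \<open>A\<close> suffices to repair the alternating sum. Since the weight \<open>c\<close> of \<open>\<bar>L\<bar>\<close> is at least \<open>1\<close>,
  repairing it completely is optimal, and the distance from \<open>v\<close> to the span of
  \<open>x\<^sub>i\<close>, \<open>i \<in> A\<close>, for nonempty \<open>A\<close> is exactly the mass of \<open>v\<close> off \<open>A\<close> plus the modulus of the
  alternating sum of \<open>v\<close> off \<open>A\<close> (\<open>gap_le_norm_diff\<close>, \<open>gap_attained\<close>). This does not depend on
  \<open>c\<close>, lies between the mass off \<open>A\<close> and twice that mass, and a \<open>\<tau>\<close>-thresholding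
  set minimises the mass off a set of given size up to the factor \<open>1/\<tau>\<close> (\<open>thresholding_mass\<close>).
  So the approximation constants in the last part are even at most \<open>2/\<tau>\<close>.

  Each of the constants is the least \<open>M\<close> in a family of inequalities \<open>a p \<le> M * b p\<close> with
  \<open>b p \<ge> 0\<close>, and such a least \<open>M\<close> exists as soon as some \<open>M\<close> works and some \<open>a p\<close> is positive
  (\<open>minimum_exists\<close>). For the semi-greedy constant, the inequalities have this form
  because the distance to the span is attained.
\<close>

section \<open>Minimal constants\<close>

text \<open>
  Each condition \<open>a p \<le> M * b p\<close> is closed and stable under increasing \<open>M\<close>, so the admissible \<open>M\<close>
  form a closed ray. The index \<open>q\<close> bounds it below; it also makes the minimum positive, and the
  last conclusion turns it into a lower bound for the constant.
\<close>

lemma minimum_exists: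
  fixes a b :: "'p \<Rightarrow> real"
  assumes b: "\<And>p. p \<in> I \<Longrightarrow> b p \<ge> 0"
    and C: "\<And>p. p \<in> I \<Longrightarrow> a p \<le> C * b p"
    and q: "q \<in> I" "a q > 0"
  obtains M where "is_minimum (\<lambda>M. \<forall>p\<in>I. a p \<le> M * b p) M" "M \<le> C" "0 < M" "a q \<le> M * b q"
proof -
  define Q where "Q = {M. \<forall>p\<in>I. a p \<le> M * b p}"
  have CQ: "C \<in> Q"
    using C by (simp add: Q_def)
  have pos: "M > 0" if "M \<in> Q" for M
  proof (rule ccontr)
    assume "\<not> M > 0"
    then have "M * b q \<le> 0"
      using b[OF q(1)] by (simp add: mult_nonpos_nonneg)
    with that q show False
      by (force simp: Q_def)
  qed
  then have bdd: "bdd_below Q"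
    by (meson bdd_belowI less_imp_le)
  have "a p \<le> Inf Q * b p" if p: "p \<in> I" for p
  proof (cases "b p = 0")
    case True
    then show ?thesis
      using C[OF p] by simp
  next
    case False
    then have bp: "b p > 0"
      using b[OF p] by simp
    have "a p / b p \<le> Inf Q"
      using CQ p bp by (intro cInf_greatest) (auto simp: Q_def field_simps)
    with bp show ?thesis
      by (simp add: field_simps)
  qed
  then have mem: "Inf Q \<in> Q"
    by (simp add: Q_def)
  show ?thesis
  proof (rule that)
    show "is_minimum (\<lambda>M. \<forall>p\<in>I. a p \<le> M * b p) (Inf Q)"
      using mem cInf_lower[OF _ bdd] by (auto simp: is_minimum_def Q_def)
    show "Inf Q \<le> C"
      using cInf_lower[OF CQ bdd] .
    show "0 < Inf Q" "a q \<le> Inf Q * b q"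
      using pos[OF mem] mem q by (auto simp: Q_def)
  qed
qed

section \<open>Greedy orderings and thresholding sets\<close>

text \<open>
  A greedy ordering arises by repeatedly removing the least index at which the remaining
  coefficients are maximal; taking the least one realises the rule for ties.
\<close>

definition greedy_pick :: "(nat \<Rightarrow> real) \<Rightarrow> nat set \<Rightarrow> nat" where
  "greedy_pick r F = (LEAST i. 2 \<le> i \<and> i \<notin> F \<and> (\<forall>j\<ge>2. j \<notin> F \<longrightarrow> r j \<le> r i))"

primrec picked :: "(nat \<Rightarrow> real) \<Rightarrow> nat \<Rightarrow> nat set" where
  "picked r 0 = {}"
| "picked r (Suc n) = insert (greedy_pick r (picked r n)) (picked r n)"

lemma finite_superlevel:
  fixes r :: "nat \<Rightarrow> real"
  assumes "r \<longlonglongrightarrow> 0" "0 < e"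
  shows "finite {i. e \<le> r i}"
proof -
  have "eventually (\<lambda>i. r i < e) sequentially"
    using order_tendstoD(2)[OF assms] .
  then obtain N where "\<And>i. i \<ge> N \<Longrightarrow> r i < e"
    by (auto simp: eventually_sequentially)
  then have "{i. e \<le> r i} \<subseteq> {..<N}"
    by (force simp: not_le[symmetric])
  then show ?thesis
    using finite_subset by blast
qed

lemma maximizer_exists:
  fixes r :: "nat \<Rightarrow> real"
  assumes r: "r \<longlonglongrightarrow> 0" "\<And>i. 0 \<le> r i" and F: "finite F"
  shows "\<exists>i. 2 \<le> i \<and> i \<notin> F \<and> (\<forall>j\<ge>2. j \<notin> F \<longrightarrow> r j \<le> r i)"
proof (cases "\<exists>k\<ge>2. k \<notin> F \<and> r k > 0")
  case True
  then obtain k where k: "k \<ge> 2" "k \<notin> F" "r k > 0"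
    by blast
  define T where "T = {i. r k \<le> r i} \<inter> ({2..} - F)"
  have T: "finite T" "k \<in> T"
    using finite_superlevel[OF r(1) k(3)] k by (auto simp: T_def)
  define i where "i = arg_min_on (\<lambda>i. - r i) T"
  have i: "i \<in> T" "\<And>j. j \<in> T \<Longrightarrow> r j \<le> r i"
    using arg_min_if_finite(1)[of T "\<lambda>i. - r i"] arg_min_least[of T _ "\<lambda>i. - r i"] T
    by (auto simp: i_def)
  have "r j \<le> r i" if "j \<ge> 2" "j \<notin> F" for j
  proof (cases "r k \<le> r j")
    case False
    then show ?thesis
      using i(2)[OF T(2)] by simp
  qed (use i that in \<open>auto simp: T_def\<close>)
  with i(1) show ?thesis
    by (auto simp: T_def)
next
  case False
  have "infinite ({2..} - F)"
    using F by (simp add: Diff_infinite_finite infinite_Ici)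
  then obtain i where "i \<in> {2..} - F"
    using infinite_imp_nonempty by blast
  with False show ?thesis
    using r(2) by (meson DiffD1 DiffD2 atLeast_iff not_less order_trans)
qed

lemma greedy_pick:
  fixes r :: "nat \<Rightarrow> real"
  assumes "r \<longlonglongrightarrow> 0" "\<And>i. 0 \<le> r i" "finite F"
  shows "2 \<le> greedy_pick r F" "greedy_pick r F \<notin> F"
    and "\<And>j. 2 \<le> j \<Longrightarrow> j \<notin> F \<Longrightarrow> r j \<le> r (greedy_pick r F)"
    and "\<And>j. 2 \<le> j \<Longrightarrow> j \<notin> F \<Longrightarrow> r j = r (greedy_pick r F) \<Longrightarrow> greedy_pick r F \<le> j"
proof -
  have *: "2 \<le> greedy_pick r F \<and> greedy_pick r F \<notin> F \<and>
      (\<forall>j\<ge>2. j \<notin> F \<longrightarrow> r j \<le> r (greedy_pick r F))"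
    unfolding greedy_pick_def by (rule LeastI_ex[OF maximizer_exists[OF assms]])
  then show "2 \<le> greedy_pick r F" "greedy_pick r F \<notin> F"
    and "\<And>j. 2 \<le> j \<Longrightarrow> j \<notin> F \<Longrightarrow> r j \<le> r (greedy_pick r F)"
    by auto
  show "greedy_pick r F \<le> j" if "2 \<le> j" "j \<notin> F" "r j = r (greedy_pick r F)" for j
    unfolding greedy_pick_def by (rule Least_le) (use * that in auto)
qed

text \<open>
  Every index \<open>i\<close> of the support is eventually picked: otherwise the infinitely many picked
  coefficients would all be at least as large as the \<open>i\<close>-th, although the coefficients tend to
  \<open>0\<close>. Once the support is exhausted, the picks run through the remaining indices in increasing
  order.
\<close>

lemma (in normed_space) greedy_ordering_exists:
  assumes lim: "(\<lambda>i. norm (x' i v)) \<longlonglongrightarrow> 0"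
  shows "is_greedy_ordering x' v (greedy_ordering x' v)"
proof -
  define r where "r = (\<lambda>i. norm (x' i v))"
  define \<rho> where "\<rho> = (\<lambda>n. greedy_pick r (picked r (n - 1)))"
  have fin: "finite (picked r n)" for n
    by (induction n) auto
  have r: "r \<longlonglongrightarrow> 0" "\<And>i. 0 \<le> r i"
    using lim by (auto simp: r_def)
  note pick = greedy_pick[OF r fin]
  have mono: "picked r m \<subseteq> picked r n" if "m \<le> n" for m n
    using that by (induction rule: dec_induct) auto
  have in_picked: "\<rho> i \<in> picked r j" if "1 \<le> i" "i \<le> j" for i j
    using mono[of i j] that by (cases i) (auto simp: \<rho>_def)
  have notin: "\<rho> j \<notin> picked r i" if "i < j" for i j
  proof -
    have "picked r i \<subseteq> picked r (j - 1)"
      using that by (intro mono) auto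
    then show ?thesis
      using pick(2)[of "j - 1"] unfolding \<rho>_def by blast
  qed
  have inj: "inj_on \<rho> {1..}"
  proof (rule linorder_inj_onI)
    fix i j :: nat assume "i < j" "i \<in> {1..}"
    then show "\<rho> i \<noteq> \<rho> j"
      using in_picked[of i i] notin[of i j] by auto
  qed auto
  have ge2: "2 \<le> \<rho> i" for i
    using pick(1) by (simp add: \<rho>_def)
  have dec: "r (\<rho> j) \<le> r (\<rho> i)" if "1 \<le> i" "i \<le> j" for i j
    using pick(3)[of "\<rho> j" "i - 1"] notin[of "i - 1" j] ge2 that by (auto simp: \<rho>_def)
  have tie: "\<rho> i < \<rho> j" if "1 \<le> i" "i < j" "r (\<rho> i) = r (\<rho> j)" for i j
  proof -
    have "\<rho> i \<le> \<rho> j"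
      using pick(4)[of "\<rho> j" "i - 1"] notin[of "i - 1" j] ge2 that by (auto simp: \<rho>_def)
    moreover have "\<rho> i \<noteq> \<rho> j"
      using inj_onD[OF inj, of i j] that by auto
    ultimately show ?thesis
      by simp
  qed
  have supp: "supp x' v \<subseteq> \<rho> ` {1..}"
  proof
    fix i assume "i \<in> supp x' v"
    then have i: "2 \<le> i" "r i > 0"
      by (auto simp: supp_def r_def)
    show "i \<in> \<rho> ` {1..}"
    proof (rule ccontr)
      assume not: "i \<notin> \<rho> ` {1..}"
      have out: "i \<notin> picked r n" for n
      proof (induction n)
        case (Suc n)
        have "greedy_pick r (picked r n) = \<rho> (Suc n)"
          by (simp add: \<rho>_def)
        with Suc not show ?case
          by auto
      qed simp
      have "\<rho> ` {1..} \<subseteq> {j. r i \<le> r j}"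
        using pick(3)[OF i(1) out] by (auto simp: \<rho>_def)
      then have "finite (\<rho> ` {1..})"
        using finite_superlevel[OF r(1) i(2)] finite_subset by blast
      then show False
        using finite_imageD[OF _ inj] infinite_Ici by blast
    qed
  qed
  have "is_greedy_ordering x' v \<rho>"
    unfolding is_greedy_ordering_def using inj ge2 supp dec tie by (auto simp: r_def)
  then show ?thesis
    unfolding greedy_ordering_def by (rule someI[of "is_greedy_ordering x' v"])
qed

text \<open>
  Indices outside the range of the ordering have coefficient \<open>0\<close>, so they cannot violate the
  threshold condition. This lemma lets all greedy estimates be read off from those for
  thresholding sets.
\<close>

lemma (in normed_space) greedy_set_weak_thresholding:
  assumes "(\<lambda>i. norm (x' i v)) \<longlonglongrightarrow> 0"
  shows "weak_thresholding_set x' 1 v m (greedy_set x' m v)"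
proof -
  define \<rho> where "\<rho> = greedy_ordering x' v"
  have \<rho>: "inj_on \<rho> {1..}" "\<rho> ` {1..} \<subseteq> {2..}" "supp x' v \<subseteq> \<rho> ` {1..}"
    and dec: "\<And>i j. 1 \<le> i \<Longrightarrow> i \<le> j \<Longrightarrow> norm (x' (\<rho> j) v) \<le> norm (x' (\<rho> i) v)"
    using greedy_ordering_exists[of x' v, OF assms] unfolding is_greedy_ordering_def \<rho>_def by blast+
  have eq: "greedy_set x' m v = \<rho> ` {1..m}"
    by (simp add: greedy_set_def \<rho>_def)
  have "1 * norm (x' j v) \<le> norm (x' i v)"
    if i: "i \<in> \<rho> ` {1..m}" and j: "j \<in> {2..} - \<rho> ` {1..m}" for i j
  proof (cases "x' j v = 0")
    case False
    then obtain k where k: "k \<ge> 1" "j = \<rho> k"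
      using \<rho>(3) j by (auto simp: supp_def)
    with j have "k > m"
      by (metis DiffD2 atLeastAtMost_iff imageI not_less)
    moreover obtain l where "i = \<rho> l" "1 \<le> l" "l \<le> m"
      using i by auto
    ultimately show ?thesis
      using k dec[of l k] by simp
  qed simp
  moreover have "\<rho> ` {1..m} \<subseteq> {2..}"
    using \<rho>(2) by fastforce
  moreover have "card (\<rho> ` {1..m}) = m"
    using card_image[OF inj_on_subset[OF \<rho>(1), of "{1..m}"]] by auto
  ultimately show ?thesis
    unfolding weak_thresholding_set_def eq by blast
qed

lemma sum_le_sum_if_card_le:
  fixes f g :: "'a \<Rightarrow> real"
  assumes fin: "finite P" "finite Q" and card: "card P \<le> card Q"
    and le: "\<And>i j. i \<in> Q \<Longrightarrow> j \<in> P \<Longrightarrow> g j \<le> f i"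
    and nonneg: "\<And>i. i \<in> Q \<Longrightarrow> 0 \<le> f i"
  shows "sum g P \<le> sum f Q"
proof (cases "Q = {}")
  case False
  define \<mu> where "\<mu> = Min (f ` Q)"
  have \<mu>: "0 \<le> \<mu>" "\<And>j. j \<in> P \<Longrightarrow> g j \<le> \<mu>" "\<And>i. i \<in> Q \<Longrightarrow> \<mu> \<le> f i"
    using False fin le nonneg by (auto simp: \<mu>_def)
  have "sum g P \<le> of_nat (card P) * \<mu>"
    using \<mu>(2) by (rule sum_bounded_above)
  also have "\<dots> \<le> of_nat (card Q) * \<mu>"
    using card \<mu>(1) by (simp add: mult_right_mono)
  also have "\<dots> \<le> sum f Q"
    using \<mu>(3) by (rule sum_bounded_below)
  finally show ?thesis .
qed (use fin card in auto)

section \<open>Coordinates and norm of \<open>\<ell>\<^sub>1\<close>\<close>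

lemmas coord_simps = zero_l1.rep_eq plus_l1.rep_eq minus_l1.rep_eq uminus_l1.rep_eq
  scaleR_l1.rep_eq l1_scale.rep_eq l1_unit.rep_eq

lemma coord_sum: "coord (sum f A) i = (\<Sum>a\<in>A. coord (f a) i)"
  by (induction A rule: infinite_finite_induct) (auto simp: coord_simps)

lemma coord_0 [simp]: "coord v 0 = 0"
  using coord[of v] by simp

lemma l1_eqI: "(\<And>i. 1 \<le> i \<Longrightarrow> coord v i = coord w i) \<Longrightarrow> v = w"
  by (metis coord_0 coord_inject ext less_one not_le)

lemma summable_norm_coord: "summable (\<lambda>i. norm (coord v i))"
  using coord[of v] by simp

lemma norm_coord_summable_on: "(\<lambda>i. norm (coord v i)) summable_on A"
proof -
  have "(\<lambda>i. norm (coord v i)) summable_on UNIV"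
    using summable_norm_coord by (simp add: summable_on_UNIV_nonneg_real_iff)
  then show ?thesis
    by (rule summable_on_subset_banach) simp
qed

definition mass :: "nat set \<Rightarrow> 'k::real_normed_vector l1 \<Rightarrow> real" where
  "mass A v = (\<Sum>\<^sub>\<infinity>i\<in>A. norm (coord v i))"

definition alt_sum :: "nat set \<Rightarrow> 'k::{real_normed_field, banach} l1 \<Rightarrow> 'k" where
  "alt_sum A v = (\<Sum>\<^sub>\<infinity>i\<in>A. (- 1) ^ i * coord v i)"

lemma norm_signed: "norm ((- 1) ^ i * (a :: 'k::real_normed_field)) = norm a"
  by (simp add: norm_mult norm_power)

lemma signed_summable_on:
  fixes v :: "'k::{real_normed_field, banach} l1"
  shows "(\<lambda>i. (- 1) ^ i * coord v i) summable_on A"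
  by (rule abs_summable_summable) (simp add: norm_signed norm_coord_summable_on)

lemma mass_nonneg: "0 \<le> mass A v"
  unfolding mass_def by (rule infsum_nonneg) simp

lemma mass_mono: "A \<subseteq> B \<Longrightarrow> mass A v \<le> mass B v"
  unfolding mass_def by (rule infsum_mono_neutral) (auto intro: norm_coord_summable_on)

lemma norm_alt_sum_le: "norm (alt_sum A v) \<le> mass A v"
  unfolding alt_sum_def mass_def
  using norm_infsum_bound[of "\<lambda>i. (- 1) ^ i * coord v i" A]
  by (simp add: norm_signed norm_coord_summable_on)

lemma mass_Un: "A \<inter> B = {} \<Longrightarrow> mass (A \<union> B) v = mass A v + mass B v"
  unfolding mass_def by (rule infsum_Un_disjoint) (auto intro: norm_coord_summable_on)

lemma alt_sum_Un: "A \<inter> B = {} \<Longrightarrow> alt_sum (A \<union> B) v = alt_sum A v + alt_sum B v"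
  unfolding alt_sum_def by (rule infsum_Un_disjoint) (auto intro: signed_summable_on)

lemma mass_finite: "finite A \<Longrightarrow> mass A v = (\<Sum>i\<in>A. norm (coord v i))"
  unfolding mass_def by simp

lemma alt_sum_finite: "finite A \<Longrightarrow> alt_sum A v = (\<Sum>i\<in>A. (- 1) ^ i * coord v i)"
  unfolding alt_sum_def by simp

lemma mass_cong:
  assumes "\<And>i. i \<in> A \<inter> B \<Longrightarrow> norm (coord v i) = norm (coord w i)"
    and "\<And>i. i \<in> A - B \<Longrightarrow> coord v i = 0" "\<And>i. i \<in> B - A \<Longrightarrow> coord w i = 0"
  shows "mass A v = mass B w"
  unfolding mass_def by (rule infsum_cong_neutral) (use assms in auto)

lemma alt_sum_cong:
  assumes "\<And>i. i \<in> A \<inter> B \<Longrightarrow> coord v i = coord w i"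
    and "\<And>i. i \<in> A - B \<Longrightarrow> coord v i = 0" "\<And>i. i \<in> B - A \<Longrightarrow> coord w i = 0"
  shows "alt_sum A v = alt_sum B w"
  unfolding alt_sum_def by (rule infsum_cong_neutral) (use assms in auto)

lemma norm_l1_mass: "norm v = norm (coord v 1) + mass {2..} v"
proof -
  have "norm v = mass UNIV v"
    unfolding mass_def norm_l1.rep_eq
    using summable_norm_coord[of v]
    by (metis has_sum_imp_sums has_sum_infsum norm_coord_summable_on sums_unique)
  also have "(UNIV :: nat set) = {0} \<union> ({1} \<union> {2..})"
    by auto
  also have "mass \<dots> v = mass {0} v + (mass {1} v + mass {2..} v)"
    by (subst mass_Un; (subst mass_Un)?; simp)
  finally show ?thesis
    by (simp add: mass_finite)
qed

lemma norm_coord_le: "norm (coord v i) \<le> norm v"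
  unfolding norm_l1.rep_eq
  using sum_le_suminf[OF summable_norm_coord[of v], of "{i}"] by simp

lemma bounded_linear_coord: "bounded_linear (\<lambda>v. coord v i)"
  by (rule bounded_linear_intro[where K = 1]) (auto simp: coord_simps norm_coord_le)

lemma alt_sum_add: "alt_sum A (v + w) = alt_sum A v + alt_sum A w"
  unfolding alt_sum_def coord_simps distrib_left
  by (rule infsum_add) (rule signed_summable_on)+

lemma alt_sum_scale: "alt_sum A (l1_scale a v) = a * alt_sum A v"
  unfolding alt_sum_def coord_simps
  using infsum_cmult_right[of a "\<lambda>i. (- 1) ^ i * coord v i" A]
  by (simp add: signed_summable_on mult.left_commute)

lemma l1_scale_of_real: "l1_scale (of_real r) v = r *\<^sub>R v"
  by (rule l1_eqI) (simp add: coord_simps scaleR_conv_of_real)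

lemma bounded_linear_alt_sum:
  "bounded_linear (alt_sum {2..} :: 'k::{real_normed_field, banach} l1 \<Rightarrow> 'k)"
proof (rule bounded_linear_intro[where K = 1])
  fix v w :: "'k l1" and r :: real
  show "alt_sum {2..} (v + w) = alt_sum {2..} v + alt_sum {2..} w"
    by (rule alt_sum_add)
  show "alt_sum {2..} (r *\<^sub>R v) = r *\<^sub>R alt_sum {2..} v"
    using alt_sum_scale[of "{2..}" "of_real r" v] by (simp add: l1_scale_of_real scaleR_conv_of_real)
  show "norm (alt_sum {2..} v) \<le> norm v * 1"
    using norm_alt_sum_le[of "{2..}" v] by (simp add: norm_l1_mass add_increasing)
qed

lemma alt_sum_sums:
  fixes v :: "'k::{real_normed_field, banach} l1"
  shows "(\<lambda>k. (- 1) ^ k * coord v (k + 2)) sums alt_sum {2..} v"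
proof -
  have bij: "bij_betw (\<lambda>k. k + 2) UNIV {2::nat..}"
    by (rule bij_betwI[where g = "\<lambda>k. k - 2"]) auto
  have "((\<lambda>i. (- 1) ^ i * coord v i) has_sum alt_sum {2..} v) {2..}"
    unfolding alt_sum_def by (rule has_sum_infsum[OF signed_summable_on])
  then have "((\<lambda>k. (- 1) ^ (k + 2) * coord v (k + 2)) has_sum alt_sum {2..} v) UNIV"
    using has_sum_reindex_bij_betw[OF bij, of "\<lambda>i. (- 1) ^ i * coord v i" "alt_sum {2..} v"]
    by simp
  from has_sum_imp_sums[OF this] show ?thesis
    by simp
qed

text \<open>
  The norm of the \<open>n\<close>-th remainder is the tail \<open>\<Sum>\<^sub>i\<^sub>>\<^sub>n \<bar>v\<^sub>i\<bar>\<close> of a convergent series.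
\<close>

lemma unit_expansion_sums:
  fixes v :: "'k::real_normed_field l1"
  shows "(\<lambda>k. l1_scale (coord v (k + 1)) (l1_unit (k + 1))) sums v"
proof -
  define p where "p n = (\<Sum>k<n. l1_scale (coord v (k + 1)) (l1_unit (k + 1)))" for n
  have coord_p: "coord (v - p n) i = (if i \<le> n then 0 else coord v i)" for n i
  proof -
    have "coord (p n) i = (\<Sum>k<n. if k + 1 = i then coord v i else 0)"
      unfolding p_def coord_sum coord_simps by (rule sum.cong) auto
    also have "\<dots> = (if 1 \<le> i \<and> i \<le> n then coord v i else 0)"
      by (cases i) auto
    finally show ?thesis
      by (cases i) (auto simp: coord_simps)
  qed
  have "norm (v - p n) = norm v - (\<Sum>i<Suc n. norm (coord v i))" for n
  proof -
    have "norm (v - p n) = (\<Sum>i. norm (coord (v - p n) (i + Suc n)))"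
      unfolding norm_l1.rep_eq
      using suminf_split_initial_segment[OF summable_norm_coord[of "v - p n"], of "Suc n"]
      by (simp add: coord_p)
    also have "\<dots> = (\<Sum>i. norm (coord v (i + Suc n)))"
      by (simp add: coord_p)
    finally show ?thesis
      unfolding norm_l1.rep_eq[of v]
      using suminf_split_initial_segment[OF summable_norm_coord[of v], of "Suc n"] by simp
  qed
  moreover have "(\<lambda>n. norm v - (\<Sum>i<Suc n. norm (coord v i))) \<longlonglongrightarrow> norm v - norm v"
    unfolding norm_l1.rep_eq
    by (intro tendsto_intros LIMSEQ_Suc summable_LIMSEQ summable_norm_coord)
  ultimately have "(\<lambda>n. norm (p n - v)) \<longlonglongrightarrow> 0"
    by (simp add: norm_minus_commute)
  then have "p \<longlonglongrightarrow> v"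
    by (metis LIM_zero_iff tendsto_norm_zero_iff)
  then show ?thesis
    unfolding sums_def p_def .
qed

lemma l1_scale_sums:
  fixes v :: "'k::real_normed_field l1"
  assumes "a sums s"
  shows "(\<lambda>k. l1_scale (a k) v) sums l1_scale s v"
proof -
  have "bounded_linear (\<lambda>a. l1_scale a v)"
    by (rule bounded_linear_intro[where K = "norm v"])
      (auto simp: l1.scale_left_distrib l1.norm_scale intro!: l1_eqI simp: coord_simps)
  from bounded_linear.sums[OF this assms] show ?thesis .
qed

section \<open>The tilted unit vectors\<close>

text \<open>
  The tilt \<open>c\<close> stands for \<open>2 (\<alpha> + 1)\<close>. The condition \<open>c \<ge> 1\<close> makes it optimal to repair
  the alternating sum completely; see \<open>gap_le_norm_diff\<close>.
\<close>

locale tilted_units =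
  fixes c :: real
    and x :: "nat \<Rightarrow> 'k::{real_normed_field, banach} l1"
    and X :: "'k l1 set"
    and x' :: "nat \<Rightarrow> 'k l1 \<Rightarrow> 'k"
  assumes c: "c \<ge> 1"
    and x: "\<And>i. i \<ge> 2 \<Longrightarrow> x i = l1_unit i + l1_scale (of_real (c * (- 1) ^ i)) (l1_unit 1)"
    and X: "X = closure (l1.span (x ` {2..}))"
    and x': "\<And>i. i \<ge> 2 \<Longrightarrow> x' i = restrict (l1_coord i) X"
begin

lemma coord_x: "i \<ge> 2 \<Longrightarrow> j \<ge> 2 \<Longrightarrow> coord (x i) j = (if j = i then 1 else 0)"
  by (simp add: x coord_simps)

lemma coord_x_1: "i \<ge> 2 \<Longrightarrow> coord (x i) 1 = of_real c * (- 1) ^ i"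
  by (simp add: x coord_simps)

text \<open>The explicit description of \<open>X\<close> as the kernel of a bounded functional.\<close>

definition tilted_plane :: "'k l1 set" where
  "tilted_plane = {v. coord v 1 = of_real c * alt_sum {2..} v}"

lemma x_in_tilted_plane: "i \<ge> 2 \<Longrightarrow> x i \<in> tilted_plane"
  using alt_sum_cong[of "{2..}" "{i}" "x i" "x i"]
  by (simp add: tilted_plane_def coord_x coord_x_1[unfolded One_nat_def] alt_sum_finite)

lemma subspace_tilted_plane: "l1.subspace tilted_plane"
proof (rule l1.subspaceI)
  show "0 \<in> tilted_plane"
    by (simp add: tilted_plane_def coord_simps alt_sum_def)
  show "v + w \<in> tilted_plane" if "v \<in> tilted_plane" "w \<in> tilted_plane" for v w
    using that by (simp add: tilted_plane_def coord_simps alt_sum_add distrib_left)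
  show "l1_scale a v \<in> tilted_plane" if "v \<in> tilted_plane" for a v
    using that by (simp add: tilted_plane_def coord_simps alt_sum_scale)
qed

lemma closed_tilted_plane: "closed tilted_plane"
  unfolding tilted_plane_def
  by (intro closed_Collect_eq continuous_on_mult continuous_on_const
      linear_continuous_on bounded_linear_coord bounded_linear_alt_sum)

text \<open>
  The expansion of \<open>v\<close> in the unit vectors, with the term of \<open>e\<^sub>1\<close> replaced by the series of its
  contributions \<open>c (-1)\<^sup>i v\<^sub>i e\<^sub>1\<close>; their sum is \<open>v\<^sub>1 e\<^sub>1\<close> by the equation that defines the plane.
\<close>

lemma expansion_sums:
  assumes "v \<in> tilted_plane"
  shows "(\<lambda>k. l1_scale (coord v (k + 2)) (x (k + 2))) sums v"
proof -
  have "(\<lambda>k. l1_scale (coord v (Suc k + 1)) (l1_unit (Suc k + 1)))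
      sums (v - l1_scale (coord v 1) (l1_unit 1))"
    using unit_expansion_sums[of v] by (subst sums_Suc_iff) simp
  moreover have "(\<lambda>k. l1_scale (of_real c * ((- 1) ^ k * coord v (k + 2))) (l1_unit 1))
      sums l1_scale (of_real c * alt_sum {2..} v) (l1_unit 1)"
    by (intro l1_scale_sums sums_mult alt_sum_sums)
  ultimately have "(\<lambda>k. l1_scale (coord v (Suc k + 1)) (l1_unit (Suc k + 1)) +
      l1_scale (of_real c * ((- 1) ^ k * coord v (k + 2))) (l1_unit 1)) sums
      (v - l1_scale (coord v 1) (l1_unit 1) + l1_scale (of_real c * alt_sum {2..} v) (l1_unit 1))"
    by (rule sums_add)
  moreover have "l1_scale (coord v (Suc k + 1)) (l1_unit (Suc k + 1)) +
      l1_scale (of_real c * ((- 1) ^ k * coord v (k + 2))) (l1_unit 1) =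
      l1_scale (coord v (k + 2)) (x (k + 2))" for k
    by (simp add: x l1.scale_right_distrib mult_ac)
  ultimately show ?thesis
    using assms by (simp add: tilted_plane_def)
qed

lemma X_eq_tilted_plane: "X = tilted_plane"
proof
  have "l1.span (x ` {2..}) \<subseteq> tilted_plane"
    by (rule l1.span_minimal) (auto simp: x_in_tilted_plane subspace_tilted_plane)
  then show "X \<subseteq> tilted_plane"
    unfolding X by (rule closure_minimal) (rule closed_tilted_plane)
  show "tilted_plane \<subseteq> X"
  proof
    fix v assume "v \<in> tilted_plane"
    then have "(\<lambda>n. \<Sum>k<n. l1_scale (coord v (k + 2)) (x (k + 2))) \<longlonglongrightarrow> v"
      using expansion_sums by (simp add: sums_def)
    moreover have "(\<Sum>k<n. l1_scale (coord v (k + 2)) (x (k + 2))) \<in> l1.span (x ` {2..})" for n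
      by (intro l1.span_sum l1.span_scale l1.span_base) auto
    ultimately show "v \<in> X"
      unfolding X closure_sequential
      by (intro exI[of _ "\<lambda>n. \<Sum>k<n. l1_scale (coord v (k + 2)) (x (k + 2))"]) auto
  qed
qed

lemmas x_in_X = x_in_tilted_plane[folded X_eq_tilted_plane]
lemmas subspace_X = subspace_tilted_plane[folded X_eq_tilted_plane]

lemma coord_1_X: "v \<in> X \<Longrightarrow> coord v 1 = of_real c * alt_sum {2..} v"
  by (simp add: X_eq_tilted_plane tilted_plane_def)

lemma x'_eq: "i \<ge> 2 \<Longrightarrow> v \<in> X \<Longrightarrow> x' i v = coord v i"
  by (simp add: x' l1_coord_def)

lemma norm_X: "v \<in> X \<Longrightarrow> norm v = mass {2..} v + c * norm (alt_sum {2..} v)"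
  using c by (simp add: norm_l1_mass coord_1_X[unfolded One_nat_def] norm_mult)

lemma mass_le_norm: "mass {2..} v \<le> norm v"
  by (simp add: norm_l1_mass)

lemma norm_X_le: "v \<in> X \<Longrightarrow> norm v \<le> (1 + c) * mass {2..} v"
  using c norm_alt_sum_le[of "{2..}" v] by (simp add: norm_X distrib_right mult_left_mono)

lemma X_eqI:
  assumes "v \<in> X" "w \<in> X" "\<And>i. i \<ge> 2 \<Longrightarrow> coord v i = coord w i"
  shows "v = w"
proof (rule l1_eqI)
  have "alt_sum {2..} v = alt_sum {2..} w"
    by (rule alt_sum_cong) (use assms in auto)
  then have "coord v 1 = coord w 1"
    using assms by (simp add: coord_1_X[unfolded One_nat_def])
  then show "coord v i = coord w i" if "i \<ge> 1" for i
    using assms(3)[of i] that by (cases "i = 1") auto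
qed

subsection \<open>Finite combinations and projections\<close>

lemma combination_in_X: "A \<subseteq> {2..} \<Longrightarrow> (\<Sum>i\<in>A. l1_scale (b i) (x i)) \<in> X"
  by (intro l1.subspace_sum[OF subspace_X] l1.subspace_scale[OF subspace_X] x_in_X) auto

lemma coord_combination:
  assumes "finite A" "A \<subseteq> {2..}" "j \<ge> 2"
  shows "coord (\<Sum>i\<in>A. l1_scale (b i) (x i)) j = (if j \<in> A then b j else 0)"
proof -
  have "coord (\<Sum>i\<in>A. l1_scale (b i) (x i)) j = (\<Sum>i\<in>A. if j = i then b i else 0)"
    unfolding coord_sum coord_simps using assms by (intro sum.cong) (auto simp: coord_x)
  then show ?thesis
    using assms by simp
qed

lemma proj_eq: "A \<subseteq> {2..} \<Longrightarrow> v \<in> X \<Longrightarrow> l1.proj x x' A v = (\<Sum>i\<in>A. l1_scale (coord v i) (x i))"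
  unfolding l1.proj_def by (intro sum.cong) (auto simp: x'_eq)

lemma proj_residual:
  assumes "finite A" "A \<subseteq> {2..}" "v \<in> X"
  shows "l1.proj x x' A v \<in> X" "v - l1.proj x x' A v \<in> X"
    and "mass {2..} (l1.proj x x' A v) = mass A v"
    and "mass {2..} (v - l1.proj x x' A v) = mass ({2..} - A) v"
proof -
  show "l1.proj x x' A v \<in> X"
    using assms by (simp add: proj_eq combination_in_X)
  then show "v - l1.proj x x' A v \<in> X"
    using l1.subspace_diff[OF subspace_X] assms by blast
  show "mass {2..} (l1.proj x x' A v) = mass A v"
    using assms by (intro mass_cong) (auto simp: proj_eq coord_combination)
  show "mass {2..} (v - l1.proj x x' A v) = mass ({2..} - A) v"
    using assms by (intro mass_cong) (auto simp: proj_eq coord_combination coord_simps)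
qed

lemma markushevich: "l1.markushevich_basis X x x'"
  unfolding l1.markushevich_basis_def
proof (intro conjI allI ballI impI)
  show "X = closure (l1.span (x ` {2..}))"
    by (rule X)
  fix i :: nat assume i: "i \<ge> 2"
  show "l1.bounded_functional_on X (x' i)"
    unfolding l1.bounded_functional_on_def
    using i l1.subspace_add[OF subspace_X] l1.subspace_scale[OF subspace_X]
    by (auto simp: x'_eq coord_simps intro!: exI[of _ 1] norm_coord_le)
  show "x' i (x j) = (if i = j then 1 else 0)" if "j \<ge> 2" for j
    using i that by (simp add: x'_eq x_in_X coord_x)
next
  fix v assume v: "v \<in> X" "\<forall>i\<ge>2. x' i v = 0"
  show "v = 0"
    by (rule X_eqI) (use v l1.subspace_0[OF subspace_X] in \<open>auto simp: x'_eq coord_simps\<close>)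
qed

lemma bounded_functionals: "l1.bounded_functionals X x'"
  unfolding l1.bounded_functionals_def
  by (auto simp: x'_eq intro!: exI[of _ 1] norm_coord_le)

subsection \<open>Equivalence with the unit vectors\<close>

lemma shifted_range: "range (\<lambda>k. x (k + 2)) = x ` {2..}"
proof -
  have "{2..} = range (\<lambda>k. k + 2 :: nat)"
    using image_add_atLeast[of 2 "0 :: nat"] by (simp add: add.commute)
  then show ?thesis
    by (simp add: image_image)
qed

lemma coord_sums:
  assumes "(\<lambda>k. l1_scale (a k) (x (k + 2))) sums v"
  shows "a k = coord v (k + 2)"
proof -
  have "(\<lambda>n. coord (l1_scale (a n) (x (n + 2))) (k + 2)) sums coord v (k + 2)"
    using bounded_linear.sums[OF bounded_linear_coord assms] .
  moreover have "(\<lambda>n. coord (l1_scale (a n) (x (n + 2))) (k + 2)) = (\<lambda>n. if n = k then a n else 0)"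
    by (auto simp: coord_simps coord_x)
  ultimately show ?thesis
    using sums_single[of k a] sums_unique2 by metis
qed

lemma unit_coord_sums:
  assumes "(\<lambda>k. l1_scale (a k) (l1_unit (k + 1))) sums (v :: 'k l1)"
  shows "a k = coord v (k + 1)"
proof -
  have "(\<lambda>n. coord (l1_scale (a n) (l1_unit (n + 1))) (k + 1)) sums coord v (k + 1)"
    using bounded_linear.sums[OF bounded_linear_coord assms] .
  moreover have "(\<lambda>n. coord (l1_scale (a n) (l1_unit (n + 1))) (k + 1)) = (\<lambda>n. if n = k then a n else 0)"
    by (auto simp: coord_simps)
  ultimately show ?thesis
    using sums_single[of k a] sums_unique2 by metis
qed

lemma basic: "l1.basic_sequence (\<lambda>k. x (k + 2))"
  unfolding l1.basic_sequence_def shifted_range X[symmetric]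
proof
  fix v assume "v \<in> X"
  then have "(\<lambda>k. l1_scale (coord v (k + 2)) (x (k + 2))) sums v"
    unfolding X_eq_tilted_plane by (rule expansion_sums)
  then show "\<exists>!a. (\<lambda>k. l1_scale (a k) (x (k + 2))) sums v"
  proof (rule ex1I[where a = "\<lambda>k. coord v (k + 2)"])
    show "a = (\<lambda>k. coord v (k + 2))" if "(\<lambda>k. l1_scale (a k) (x (k + 2))) sums v" for a
      using coord_sums[OF that] by (rule ext)
  qed
qed

text \<open>
  The coordinates from \<open>2\<close> on are free; the first one is then forced by the alternating sum, which
  is computed from an auxiliary vector \<open>w\<close> with first coordinate \<open>0\<close>.
\<close>

lemma prescribed_coord:
  fixes a :: "nat \<Rightarrow> 'k"
  assumes "summable (\<lambda>k. norm (a k))"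
  obtains v where "v \<in> X" "\<And>k. coord v (k + 2) = a k"
proof -
  have u: "coord (Abs_l1 (case_nat 0 (case_nat s a))) = case_nat 0 (case_nat s a)" for s
  proof (rule Abs_l1_inverse)
    have "summable (\<lambda>i. norm (case_nat 0 (case_nat s a) (i + 2)))"
      using assms by simp
    then show "case_nat 0 (case_nat s a) \<in> {f. f 0 = 0 \<and> summable (\<lambda>i. norm (f i))}"
      by (subst (asm) summable_iff_shift) simp
  qed
  define w where "w = Abs_l1 (case_nat 0 (case_nat 0 a))"
  define v where "v = Abs_l1 (case_nat 0 (case_nat (of_real c * alt_sum {2..} w) a))"
  have vw: "coord v (k + 2) = a k" "coord w (k + 2) = a k" for k
    by (simp_all add: v_def w_def u)
  have "coord v i = coord w i" if "i \<ge> 2" for i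
    using vw that by (metis add.commute le_Suc_ex)
  then have "alt_sum {2..} v = alt_sum {2..} w"
    by (intro alt_sum_cong) auto
  then have "v \<in> X"
    by (simp add: X_eq_tilted_plane tilted_plane_def) (simp add: v_def u)
  with vw show ?thesis
    using that by blast
qed

text \<open>Both series converge exactly when the coefficients are absolutely summable.\<close>

lemma equivalent: "l1.equivalent_sequences (\<lambda>k. x (k + 2)) (\<lambda>k. l1_unit (k + 1))"
  unfolding l1.equivalent_sequences_def
proof
  fix a :: "nat \<Rightarrow> 'k"
  have "summable (\<lambda>k. l1_scale (a k) (x (k + 2))) \<longleftrightarrow> summable (\<lambda>k. norm (a k))"
  proof
    assume "summable (\<lambda>k. l1_scale (a k) (x (k + 2)))"
    then obtain v where "\<And>k. a k = coord v (k + 2)"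
      using coord_sums unfolding summable_def by blast
    then show "summable (\<lambda>k. norm (a k))"
      using summable_iff_shift[of "\<lambda>i. norm (coord v i)" 2] summable_norm_coord by simp
  next
    assume "summable (\<lambda>k. norm (a k))"
    then obtain v where "v \<in> X" "\<And>k. coord v (k + 2) = a k"
      using prescribed_coord by blast
    then show "summable (\<lambda>k. l1_scale (a k) (x (k + 2)))"
      using expansion_sums[of v] by (auto simp: X_eq_tilted_plane sums_iff)
  qed
  moreover have "summable (\<lambda>k. l1_scale (a k) (l1_unit (k + 1) :: 'k l1)) \<longleftrightarrow> summable (\<lambda>k. norm (a k))"
  proof
    assume "summable (\<lambda>k. l1_scale (a k) (l1_unit (k + 1) :: 'k l1))"
    then obtain v :: "'k l1" where "\<And>k. a k = coord v (k + 1)"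
      using unit_coord_sums unfolding summable_def by blast
    then show "summable (\<lambda>k. norm (a k))"
      using summable_iff_shift[of "\<lambda>i. norm (coord v i)" 1] summable_norm_coord by simp
  next
    assume "summable (\<lambda>k. norm (a k))"
    then have "case_nat 0 a \<in> {f. f 0 = 0 \<and> summable (\<lambda>i. norm (f i))}"
      using summable_iff_shift[of "\<lambda>i. norm (case_nat 0 a i)" 1] by simp
    from Abs_l1_inverse[OF this] show "summable (\<lambda>k. l1_scale (a k) (l1_unit (k + 1) :: 'k l1))"
      using unit_expansion_sums[of "Abs_l1 (case_nat 0 a)"] by (simp add: sums_iff)
  qed
  ultimately show "summable (\<lambda>k. l1_scale (a k) (x (k + 2))) \<longleftrightarrow>
      summable (\<lambda>k. l1_scale (a k) (l1_unit (k + 1) :: 'k l1))"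
    by simp
qed

subsection \<open>Approximation from finitely many basis vectors\<close>

text \<open>
  The distance from \<open>v\<close> to the span of \<open>x\<^sub>i\<close>, \<open>i \<in> A\<close>, if \<open>A\<close> is finite and nonempty. For
  other \<open>A\<close> it still bounds that distance from below, which also serves for the vectors \<open>y\<close> of
  empty support in \<open>sigma\<close>.
\<close>

definition gap :: "nat set \<Rightarrow> 'k l1 \<Rightarrow> real" where
  "gap A v = mass ({2..} - A) v + norm (alt_sum ({2..} - A) v)"

text \<open>
  Let \<open>w = v - z\<close>. Off \<open>A\<close> it agrees with \<open>v\<close>, so the alternating sum of \<open>v\<close> off \<open>A\<close> must be
  balanced by the coordinates of \<open>w\<close> in \<open>A\<close>, at the price of their mass, or survive in \<open>L w\<close>, at
  the price \<open>c \<ge> 1\<close> per unit. Either way it contributes its full modulus to the norm.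
\<close>

lemma gap_le_norm_diff:
  assumes vz: "v \<in> X" "z \<in> X" and z: "\<And>i. i \<ge> 2 \<Longrightarrow> i \<notin> A \<Longrightarrow> coord z i = 0"
  shows "gap A v \<le> norm (v - z)"
proof -
  define w where "w = v - z"
  have w: "w \<in> X"
    using l1.subspace_diff[OF subspace_X] vz by (simp add: w_def)
  define B where "B = {2..} - A"
  have B: "{2..} = B \<union> ({2..} \<inter> A)" "B \<inter> ({2..} \<inter> A) = {}"
    by (auto simp: B_def)
  have wv: "mass B w = mass B v" "alt_sum B w = alt_sum B v"
    by (rule mass_cong alt_sum_cong; use z in \<open>auto simp: B_def w_def coord_simps\<close>)+
  have split: "mass {2..} w = mass B v + mass ({2..} \<inter> A) w"
    "alt_sum {2..} w = alt_sum B v + alt_sum ({2..} \<inter> A) w"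
    using mass_Un[OF B(2), of w] alt_sum_Un[OF B(2), of w] B(1) wv by simp_all
  have "norm (alt_sum B v) \<le> norm (alt_sum {2..} w) + norm (alt_sum ({2..} \<inter> A) w)"
    using norm_triangle_ineq4[of "alt_sum {2..} w" "alt_sum ({2..} \<inter> A) w"] by (simp add: split)
  also have "\<dots> \<le> c * norm (alt_sum {2..} w) + mass ({2..} \<inter> A) w"
    using mult_right_mono[OF c, of "norm (alt_sum {2..} w)"] norm_alt_sum_le
    by (intro add_mono) auto
  finally show ?thesis
    using norm_X[OF w] split(1) unfolding gap_def B_def[symmetric] w_def[symmetric] by linarith
qed

text \<open>
  Copy the coordinates of \<open>v\<close> on \<open>A\<close>, except that one index \<open>p\<close> is used to make the alternating
  sum of the remainder vanish.
\<close>

lemma gap_attained: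
  assumes A: "finite A" "A \<subseteq> {2..}" "A \<noteq> {}" and v: "v \<in> X"
  shows "\<exists>b. norm (v - (\<Sum>i\<in>A. l1_scale (b i) (x i))) = gap A v"
proof -
  obtain p where p: "p \<in> A"
    using A by blast
  define B where "B = {2..} - A"
  define s where "s = alt_sum B v"
  define b where "b = (\<lambda>i. if i = p then coord v p + (- 1) ^ p * s else coord v i)"
  define w where "w = v - (\<Sum>i\<in>A. l1_scale (b i) (x i))"
  have w: "w \<in> X"
    using l1.subspace_diff[OF subspace_X v combination_in_X] A by (simp add: w_def)
  have coord_w: "coord w i = (if i = p then - ((- 1) ^ p * s) else if i \<in> A then 0 else coord v i)"
    if "i \<ge> 2" for i
    using that A p by (auto simp: w_def coord_simps coord_combination b_def)
  have B: "{2..} = B \<union> A" "B \<inter> A = {}"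
    using A by (auto simp: B_def)
  have wv: "mass B w = mass B v" "alt_sum B w = s"
    unfolding s_def
    by (rule mass_cong alt_sum_cong; use p in \<open>auto simp: B_def coord_w\<close>)+
  have "mass A w = mass {p} w" "alt_sum A w = alt_sum {p} w"
    by (rule mass_cong alt_sum_cong; use p A in \<open>auto simp: coord_w subset_iff\<close>)+
  moreover have "p \<ge> 2"
    using p A by auto
  ultimately have "mass A w = norm s" "alt_sum A w = - s"
    by (simp_all add: mass_finite alt_sum_finite coord_w norm_signed flip: mult.assoc power_add)
  then have "mass {2..} w = mass B v + norm s" "alt_sum {2..} w = 0"
    using mass_Un[OF B(2), of w] alt_sum_Un[OF B(2), of w] B(1) wv by simp_all
  then have "norm w = gap A v"
    by (simp add: norm_X[OF w] gap_def B_def s_def)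
  then show ?thesis
    unfolding w_def by blast
qed

lemma gap_attained_span:
  assumes A: "finite A" "A \<subseteq> {2..}" "A \<noteq> {}" and v: "v \<in> X"
  shows "(\<exists>z\<in>l1.span (x ` A). norm (v - z) \<le> r) \<longleftrightarrow> gap A v \<le> r"
proof
  assume "\<exists>z\<in>l1.span (x ` A). norm (v - z) \<le> r"
  then obtain z where z: "z \<in> l1.span (x ` A)" "norm (v - z) \<le> r"
    by blast
  have "z \<in> X \<and> (\<forall>i\<ge>2. i \<notin> A \<longrightarrow> coord z i = 0)"
    using z(1)
  proof (induction rule: l1.span_induct_alt)
    case base
    then show ?case
      using l1.subspace_0[OF subspace_X] by (simp add: coord_simps)
  next
    case (step a y z)
    then obtain i where i: "i \<in> A" "i \<ge> 2" "y = x i"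
      using A by auto
    with step show ?case
      using l1.subspace_add[OF subspace_X] l1.subspace_scale[OF subspace_X] x_in_X
      by (auto simp: coord_simps coord_x)
  qed
  then have "gap A v \<le> norm (v - z)"
    using v by (intro gap_le_norm_diff) auto
  with z(2) show "gap A v \<le> r"
    by simp
next
  assume "gap A v \<le> r"
  then obtain b where "norm (v - (\<Sum>i\<in>A. l1_scale (b i) (x i))) \<le> r"
    using gap_attained[OF A v] by metis
  then show "\<exists>z\<in>l1.span (x ` A). norm (v - z) \<le> r"
    by (rule bexI) (intro l1.span_sum l1.span_scale l1.span_base imageI)
qed

text \<open>
  Off \<open>W \<union> B\<close> both masses agree. What remains is \<open>B - W\<close> against \<open>W - B\<close>: the latter
  is at least as large, and each of its coefficients dominates \<open>\<tau>\<close> times any of the former.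
\<close>

lemma thresholding_mass:
  assumes v: "v \<in> X" and \<tau>: "0 < \<tau>" "\<tau> \<le> 1"
    and W: "l1.weak_thresholding_set x' \<tau> v m W"
    and B: "finite B" "B \<subseteq> {2..}" "card B \<le> m"
  shows "\<tau> * mass ({2..} - W) v \<le> mass ({2..} - B) v"
proof -
  define R where "R = {2..} - (W \<union> B)"
  have W': "finite W" "W \<subseteq> {2..}" "card W = m"
    and le: "\<And>i j. i \<in> W \<Longrightarrow> j \<in> B - W \<Longrightarrow> \<tau> * norm (coord v j) \<le> norm (coord v i)"
    using W v B by (auto simp: l1.weak_thresholding_set_def x'_eq subset_iff)
  have split: "{2..} - W = R \<union> (B - W)" "{2..} - B = R \<union> (W - B)"
    using W' B by (auto simp: R_def)
  have disj: "R \<inter> (B - W) = {}" "R \<inter> (W - B) = {}"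
    by (auto simp: R_def)
  have "card (B - W) \<le> card (W - B)"
    using card_le_sym_Diff[of B W] W' B by simp
  then have "(\<Sum>j\<in>B - W. \<tau> * norm (coord v j)) \<le> (\<Sum>i\<in>W - B. norm (coord v i))"
    using W' B le by (intro sum_le_sum_if_card_le) auto
  then have "\<tau> * mass (B - W) v \<le> mass (W - B) v"
    using W' B by (simp add: mass_finite sum_distrib_left)
  moreover have "\<tau> * mass R v \<le> mass R v"
    using \<tau> mass_nonneg[of R v] by (simp add: mult_left_le_one_le)
  ultimately show ?thesis
    unfolding split mass_Un[OF disj(1)] mass_Un[OF disj(2)] by (simp add: distrib_left)
qed

lemma greedy_set:
  assumes "v \<in> X"
  shows "l1.weak_thresholding_set x' 1 v m (l1.greedy_set x' m v)"
proof (rule l1.greedy_set_weak_thresholding)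
  have "eventually (\<lambda>i. norm (coord v i) = norm (x' i v)) sequentially"
    using eventually_ge_at_top[of 2] by eventually_elim (simp add: x'_eq assms)
  then show "(\<lambda>i. norm (x' i v)) \<longlonglongrightarrow> 0"
    by (rule Lim_transform_eventually[OF summable_LIMSEQ_zero[OF summable_norm_coord[of v]]])
qed

lemma greedy_set_facts:
  assumes "v \<in> X"
  shows "finite (l1.greedy_set x' m v)" "l1.greedy_set x' m v \<subseteq> {2..}"
    "card (l1.greedy_set x' m v) = m"
  using greedy_set[OF assms] by (auto simp: l1.weak_thresholding_set_def)

text \<open>
  The factor \<open>2\<close> is the bound of the alternating sum by the mass. For a competitor \<open>y\<close> with
  support \<open>B\<close>, the mass of \<open>v\<close> off \<open>B\<close> is at most the norm of \<open>v - y\<close>.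
\<close>

lemma gap_le_sigma:
  assumes v: "v \<in> X" and \<tau>: "0 < \<tau>" "\<tau> \<le> 1"
    and W: "l1.weak_thresholding_set x' \<tau> v m W"
  shows "gap W v \<le> 2 * inverse \<tau> * l1.sigma X x x' m v"
proof -
  let ?Y = "{norm (v - y) | y. y \<in> X \<and> finite (l1.supp x' y) \<and> card (l1.supp x' y) \<le> m \<and>
                           y = l1.proj x x' (l1.supp x' y) y}"
  have X0: "0 \<in> X"
    using l1.subspace_0[OF subspace_X] .
  then have "l1.supp x' 0 = {}"
    by (simp add: l1.supp_def x'_eq coord_simps cong: conj_cong)
  then have "norm (v - 0) \<in> ?Y"
    using X0 by (intro CollectI exI[of _ 0]) (simp add: l1.proj_def)
  then have ne: "?Y \<noteq> {}"
    by blast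
  have "\<tau> * gap W v / 2 \<le> norm (v - y)"
    if y: "y \<in> X" "finite (l1.supp x' y)" "card (l1.supp x' y) \<le> m" for y
  proof -
    let ?B = "l1.supp x' y"
    have B: "?B \<subseteq> {2..}"
      by (auto simp: l1.supp_def)
    have "gap W v \<le> 2 * mass ({2..} - W) v"
      using norm_alt_sum_le[of "{2..} - W" v] by (simp add: gap_def)
    then have "\<tau> * gap W v / 2 \<le> \<tau> * mass ({2..} - W) v"
      using \<tau> by simp
    also have "\<dots> \<le> mass ({2..} - ?B) v"
      by (rule thresholding_mass[OF v \<tau> W y(2) B y(3)])
    also have "\<dots> \<le> gap ?B v"
      by (simp add: gap_def)
    also have "\<dots> \<le> norm (v - y)"
      using v y by (intro gap_le_norm_diff) (auto simp: l1.supp_def x'_eq)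
    finally show ?thesis .
  qed
  then have "\<tau> * gap W v / 2 \<le> l1.sigma X x x' m v"
    unfolding l1.sigma_def by (intro cInf_greatest[OF ne]) auto
  then show ?thesis
    using \<tau> by (simp add: field_simps)
qed

lemma sigma_nonneg: "0 \<le> l1.sigma X x x' m v" if "v \<in> X"
proof -
  have "0 \<le> gap W v" for W
    by (simp add: gap_def mass_nonneg)
  then show ?thesis
    using gap_le_sigma[OF that _ _ greedy_set[OF that], of m]
    by (metis inverse_1 le_numeral_extra(4) mult.right_neutral mult_le_cancel_left_pos mult_zero_right
        order_trans zero_less_numeral zero_less_one)
qed

lemma thresholding_approximation:
  assumes v: "v \<in> X" and \<tau>: "0 < \<tau>" "\<tau> \<le> 1" and m: "1 \<le> m"
    and W: "l1.weak_thresholding_set x' \<tau> v m W"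
  shows "\<exists>b. norm (v - (\<Sum>i\<in>W. l1_scale (b i) (x i))) \<le> 4 * inverse \<tau> * l1.sigma X x x' m v"
proof -
  have "W \<noteq> {}" "finite W" "W \<subseteq> {2..}"
    using W m by (auto simp: l1.weak_thresholding_set_def)
  then obtain b where "norm (v - (\<Sum>i\<in>W. l1_scale (b i) (x i))) = gap W v"
    using gap_attained[OF _ _ _ v] by blast
  moreover have "2 * inverse \<tau> * l1.sigma X x x' m v \<le> 4 * inverse \<tau> * l1.sigma X x x' m v"
    using \<tau> sigma_nonneg[OF v] by (intro mult_right_mono) auto
  ultimately show ?thesis
    using gap_le_sigma[OF v \<tau> W] by (intro exI[of _ b]) linarith
qed

subsection \<open>The pair \<open>x\<^sub>2 + x\<^sub>3\<close>\<close>

definition pair :: "'k l1" where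
  "pair = x 2 + x 3"

lemma coord_pair: "i \<ge> 2 \<Longrightarrow> coord pair i = (if i = 2 \<or> i = 3 then 1 else 0)"
  by (simp add: pair_def coord_simps coord_x)

lemma pair_in_X: "pair \<in> X"
  unfolding pair_def by (intro l1.subspace_add[OF subspace_X] x_in_X) auto

lemma norm_x: "i \<ge> 2 \<Longrightarrow> norm (x i) = 1 + c"
  using mass_cong[of "{2..}" "{i}" "x i" "x i"] c
  by (simp add: norm_l1_mass coord_x coord_x_1[unfolded One_nat_def] mass_finite norm_mult norm_power)

lemma norm_pair: "norm pair = 2"
proof -
  have "mass {2..} pair = mass {2, 3} pair" "alt_sum {2..} pair = alt_sum {2, 3} pair"
    by (rule mass_cong alt_sum_cong; auto simp: coord_pair)+
  then show ?thesis
    by (simp add: norm_X[OF pair_in_X] mass_finite alt_sum_finite coord_pair)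
qed

lemma thresholding_pair:
  assumes "0 < \<tau>" "l1.weak_thresholding_set x' \<tau> pair 1 W"
  shows "norm (l1.proj x x' W pair) = 1 + c" "norm (pair - l1.proj x x' W pair) = 1 + c"
    and "gap W pair = 2"
proof -
  obtain i where W: "W = {i}" "i \<ge> 2"
    using assms by (auto simp: l1.weak_thresholding_set_def card_1_singleton_iff)
  have "i = 2 \<or> i = 3"
  proof (rule ccontr)
    assume "\<not> (i = 2 \<or> i = 3)"
    with W assms show False
      by (auto simp: l1.weak_thresholding_set_def x'_eq pair_in_X coord_pair dest!: bspec[of _ _ 2])
  qed
  then obtain j where j: "j \<ge> 2" "i \<noteq> j" "{i, j} = {2, 3}" "pair = x i + x j"
  proof
    assume "i = 2"
    then show thesis
      using that[of 3] by (simp add: pair_def)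
  next
    assume "i = 3"
    then show thesis
      using that[of 2] by (simp add: pair_def add.commute insert_commute)
  qed
  have proj: "l1.proj x x' W pair = x i"
    using W j(3) by (subst proj_eq) (auto simp: pair_in_X coord_pair)
  then show "norm (l1.proj x x' W pair) = 1 + c" "norm (pair - l1.proj x x' W pair) = 1 + c"
    using W j by (simp_all add: norm_x)
  have "coord pair k = 0" if "k \<ge> 2" "k \<noteq> i" "k \<noteq> j" for k
    using that coord_pair[of k] j(3) by auto
  then have "mass ({2..} - W) pair = mass {j} pair" "alt_sum ({2..} - W) pair = alt_sum {j} pair"
    using W(1) j(1,2) by (intro mass_cong alt_sum_cong; simp)+
  moreover have "coord pair j = 1"
    using j(1,3) by (subst coord_pair) auto
  ultimately show "gap W pair = 2"
    by (simp add: gap_def mass_finite alt_sum_finite norm_power)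
qed

lemma sigma_tilde_pair: "l1.sigma_tilde x x' 1 pair \<le> 2"
proof -
  have "l1.sigma_tilde x x' 1 pair \<le> norm (pair - l1.proj x x' {} pair)"
    unfolding l1.sigma_tilde_def
    by (rule cInf_lower) (auto intro!: exI[of _ "{}"] bdd_belowI[of _ 0])
  then show ?thesis
    by (simp add: l1.proj_def norm_pair)
qed

lemma sigma_tilde_nonneg: "0 \<le> l1.sigma_tilde x x' m v"
  unfolding l1.sigma_tilde_def by (rule cInf_greatest) (auto intro!: exI[of _ "{}"])

subsection \<open>The constants\<close>

lemma democracy: "\<exists>K. l1.democracy_constant x K \<and> (1 + c) / 2 \<le> K"
proof -
  define I :: "(nat set \<times> nat set) set"
    where "I = {(A, B). finite A \<and> finite B \<and> A \<subseteq> {2..} \<and> B \<subseteq> {2..} \<and> card A \<le> card B}"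
  have mass_sum: "mass {2..} (\<Sum>i\<in>A. x i) = card A" if "finite A" "A \<subseteq> {2..}" for A
  proof -
    have "coord (\<Sum>i\<in>A. x i) j = (if j \<in> A then 1 else 0)" if "j \<ge> 2" for j
      using coord_combination[of A j "\<lambda>_. 1"] that \<open>finite A\<close> \<open>A \<subseteq> {2..}\<close> by simp
    then have "mass {2..} (\<Sum>i\<in>A. x i) = (\<Sum>j\<in>A. 1)"
      using that mass_cong[of "{2..}" A "\<Sum>i\<in>A. x i" "\<Sum>i\<in>A. x i"]
      by (auto simp: mass_finite subset_iff)
    then show ?thesis
      by simp
  qed
  obtain M where M: "is_minimum (\<lambda>M. \<forall>p\<in>I. norm (\<Sum>i\<in>fst p. x i) \<le> M * norm (\<Sum>i\<in>snd p. x i)) M"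
    and le: "norm (\<Sum>i\<in>fst ({2}, {2, 3}). x i) \<le> M * norm (\<Sum>i\<in>snd ({2}, {2, 3}). x i)"
  proof (rule minimum_exists[of I "\<lambda>p. norm (\<Sum>i\<in>snd p. x i)" "\<lambda>p. norm (\<Sum>i\<in>fst p. x i)"
        "1 + c" "({2}, {2, 3})"])
    fix p assume "p \<in> I"
    then obtain A B where p: "p = (A, B)" "finite A" "finite B" "A \<subseteq> {2..}" "B \<subseteq> {2..}"
        "card A \<le> card B"
      by (auto simp: I_def)
    have "(\<Sum>i\<in>A. x i) \<in> X"
      using combination_in_X[OF p(4), of "\<lambda>_. 1"] by simp
    then have "norm (\<Sum>i\<in>A. x i) \<le> (1 + c) * mass {2..} (\<Sum>i\<in>A. x i)"
      by (rule norm_X_le)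
    also have "\<dots> \<le> (1 + c) * mass {2..} (\<Sum>i\<in>B. x i)"
      using c p by (intro mult_left_mono) (auto simp: mass_sum)
    also have "\<dots> \<le> (1 + c) * norm (\<Sum>i\<in>B. x i)"
      using c by (intro mult_left_mono mass_le_norm) auto
    finally show "norm (\<Sum>i\<in>fst p. x i) \<le> (1 + c) * norm (\<Sum>i\<in>snd p. x i)"
      using p by simp
  qed (use c in \<open>auto simp: I_def norm_x\<close>)
  have "(1 + c) / 2 \<le> M"
    using le norm_pair by (simp add: norm_x pair_def)
  moreover have "l1.democracy_constant x M"
    using M unfolding l1.democracy_constant_def is_minimum_def by (force simp: I_def)
  ultimately show ?thesis
    by blast
qed

text \<open>
  Passing from the norm to the mass and back costs \<open>1 + c\<close>, and a greedy set minimises the mass of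
  the remainder among all sets of at most \<open>m\<close> indices.
\<close>

lemma greedy_sum_bounds:
  assumes v: "v \<in> X"
  shows "norm (l1.greedy_sum x x' m v) \<le> (1 + c) * norm v"
    and "norm (v - l1.greedy_sum x x' m v) \<le> (1 + c) * l1.sigma_tilde x x' m v"
    and "norm (v - l1.greedy_sum x x' m v) \<le> (1 + c) * norm v"
proof -
  let ?G = "l1.greedy_set x' m v"
  note G = greedy_set_facts[OF v, of m]
  note res = proj_residual[OF G(1,2) v]
  have "norm (l1.greedy_sum x x' m v) \<le> (1 + c) * mass ?G v"
    using norm_X_le[OF res(1)] by (simp add: l1.greedy_sum_def res)
  also have "\<dots> \<le> (1 + c) * norm v"
    using c mass_mono[OF G(2), of v] mass_le_norm[of v] by (intro mult_left_mono) auto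
  finally show "norm (l1.greedy_sum x x' m v) \<le> (1 + c) * norm v" .
  have B: "norm (v - l1.greedy_sum x x' m v) \<le> (1 + c) * norm (v - l1.proj x x' B v)"
    if B: "finite B" "B \<subseteq> {2..}" "card B \<le> m" for B
  proof -
    have "norm (v - l1.greedy_sum x x' m v) \<le> (1 + c) * mass ({2..} - ?G) v"
      using norm_X_le[OF res(2)] by (simp add: l1.greedy_sum_def res)
    also have "\<dots> \<le> (1 + c) * mass ({2..} - B) v"
      using c thresholding_mass[OF v _ _ greedy_set[OF v] B] by (intro mult_left_mono) auto
    also have "\<dots> = (1 + c) * mass {2..} (v - l1.proj x x' B v)"
      by (simp add: proj_residual[OF B(1,2) v])
    also have "\<dots> \<le> (1 + c) * norm (v - l1.proj x x' B v)"
      using c by (intro mult_left_mono mass_le_norm) auto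
    finally show ?thesis .
  qed
  show "norm (v - l1.greedy_sum x x' m v) \<le> (1 + c) * norm v"
    using B[of "{}"] by (simp add: l1.proj_def)
  have "norm (v - l1.greedy_sum x x' m v) / (1 + c) \<le> l1.sigma_tilde x x' m v"
    unfolding l1.sigma_tilde_def
  proof (rule cInf_greatest)
    show "{norm (v - l1.proj x x' A v) |A. finite A \<and> A \<subseteq> {2..} \<and> card A \<le> m} \<noteq> {}"
      by (auto intro!: exI[of _ "{}"])
  qed (use B c in \<open>auto simp: field_simps\<close>)
  then show "norm (v - l1.greedy_sum x x' m v) \<le> (1 + c) * l1.sigma_tilde x x' m v"
    using c by (simp add: field_simps)
qed

lemma greedy_sum_pair:
  "norm (l1.greedy_sum x x' 1 pair) = 1 + c" "norm (pair - l1.greedy_sum x x' 1 pair) = 1 + c"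
  using thresholding_pair(1,2)[OF _ greedy_set[OF pair_in_X, of 1]]
  by (simp_all add: l1.greedy_sum_def)

lemma first_quasi_greedy: "\<exists>K. l1.first_quasi_greedy_constant X x x' K \<and> (1 + c) / 2 \<le> K"
proof -
  obtain M where
    "is_minimum (\<lambda>M. \<forall>p\<in>X \<times> {1..}. norm (l1.greedy_sum x x' (snd p) (fst p)) \<le> M * norm (fst p)) M"
    "norm (l1.greedy_sum x x' (snd (pair, 1)) (fst (pair, 1))) \<le> M * norm (fst (pair, 1))"
    by (rule minimum_exists[of "X \<times> {1..}" "\<lambda>p. norm (fst p)"
          "\<lambda>p. norm (l1.greedy_sum x x' (snd p) (fst p))" "1 + c" "(pair, 1)"])
      (use c in \<open>auto simp: pair_in_X greedy_sum_pair[unfolded One_nat_def] greedy_sum_bounds(1)\<close>)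
  then show ?thesis
    unfolding l1.first_quasi_greedy_constant_def
    by (intro exI[of _ M])
      (auto simp: greedy_sum_pair[unfolded One_nat_def] norm_pair is_minimum_def)
qed

lemma second_quasi_greedy: "\<exists>K. l1.second_quasi_greedy_constant X x x' K \<and> (1 + c) / 2 \<le> K"
proof -
  obtain M where
    "is_minimum (\<lambda>M. \<forall>p\<in>X \<times> {1..}. norm (fst p - l1.greedy_sum x x' (snd p) (fst p)) \<le> M * norm (fst p)) M"
    "norm (fst (pair, 1) - l1.greedy_sum x x' (snd (pair, 1)) (fst (pair, 1))) \<le> M * norm (fst (pair, 1))"
    by (rule minimum_exists[of "X \<times> {1..}" "\<lambda>p. norm (fst p)"
          "\<lambda>p. norm (fst p - l1.greedy_sum x x' (snd p) (fst p))" "1 + c" "(pair, 1)"])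
      (use c in \<open>auto simp: pair_in_X greedy_sum_pair[unfolded One_nat_def] greedy_sum_bounds(3)\<close>)
  then show ?thesis
    unfolding l1.second_quasi_greedy_constant_def
    by (intro exI[of _ M])
      (auto simp: greedy_sum_pair[unfolded One_nat_def] norm_pair is_minimum_def)
qed

lemma le_if_le_sigma_tilde_pair:
  assumes "1 + c \<le> M * l1.sigma_tilde x x' 1 pair"
  shows "(1 + c) / 2 \<le> M"
proof -
  have "0 < M * l1.sigma_tilde x x' 1 pair"
    using assms c by linarith
  then have "0 < M"
    using sigma_tilde_nonneg[of 1 pair] by (simp add: zero_less_mult_iff)
  then have "M * l1.sigma_tilde x x' 1 pair \<le> M * 2"
    by (intro mult_left_mono sigma_tilde_pair) auto
  with assms show ?thesis
    by simp
qed

lemma almost_greedy: "\<exists>K. l1.almost_greedy_constant X x x' K \<and> (1 + c) / 2 \<le> K"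
proof -
  obtain M where
    "is_minimum (\<lambda>M. \<forall>p\<in>X \<times> UNIV. norm (fst p - l1.greedy_sum x x' (snd p) (fst p))
        \<le> M * l1.sigma_tilde x x' (snd p) (fst p)) M"
    "norm (fst (pair, 1) - l1.greedy_sum x x' (snd (pair, 1)) (fst (pair, 1)))
        \<le> M * l1.sigma_tilde x x' (snd (pair, 1)) (fst (pair, 1))"
    by (rule minimum_exists[of "X \<times> UNIV" "\<lambda>p. l1.sigma_tilde x x' (snd p) (fst p)"
          "\<lambda>p. norm (fst p - l1.greedy_sum x x' (snd p) (fst p))" "1 + c" "(pair, 1)"])
      (use c in \<open>auto simp: pair_in_X greedy_sum_pair[unfolded One_nat_def] greedy_sum_bounds(2)
        sigma_tilde_nonneg\<close>)
  then show ?thesis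
    unfolding l1.almost_greedy_constant_def
    by (intro exI[of _ M])
      (use le_if_le_sigma_tilde_pair[of M] in
        \<open>auto simp: greedy_sum_pair[unfolded One_nat_def] is_minimum_def l1.almost_greedy_bound_def\<close>)
qed

lemma WAG_lower_bound:
  assumes "0 < \<tau>" "l1.WAG X x x' \<tau> M"
  shows "(1 + c) / 2 \<le> M"
proof -
  obtain W where "l1.weak_thresholding_set x' \<tau> pair 1 W"
    "norm (pair - l1.proj x x' W pair) \<le> M * l1.sigma_tilde x x' 1 pair"
    using assms(2) pair_in_X unfolding l1.WAG_def by blast
  then show ?thesis
    using thresholding_pair(2)[OF assms(1)] le_if_le_sigma_tilde_pair by metis
qed

text \<open>
  By \<open>gap_attained_span\<close>, the existence of a good \<open>z\<close> in the span is an inequality for \<open>gap\<close>, so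
  \<open>minimum_exists\<close> applies. The requirement \<open>M > 0\<close> follows from that inequality at \<open>x\<^sub>2 + x\<^sub>3\<close>.
\<close>

lemma semi_greedy: "\<exists>K. l1.semi_greedy_constant X x x' K \<and> K \<le> 2"
proof -
  define a where "a = (\<lambda>p. gap (l1.greedy_set x' (snd p) (fst p)) (fst p))"
  define b where "b = (\<lambda>p. l1.sigma X x x' (snd p) (fst p))"
  have a_pair: "a (pair, 1) = 2"
    using thresholding_pair(3)[OF _ greedy_set[OF pair_in_X, of 1]] by (simp add: a_def)
  have b_nonneg: "0 \<le> b p" if "p \<in> X \<times> {1..}" for p
    using that sigma_nonneg by (auto simp: b_def)
  obtain M where M: "is_minimum (\<lambda>M. \<forall>p\<in>X \<times> {1..}. a p \<le> M * b p) M" "M \<le> 2"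
  proof (rule minimum_exists[of "X \<times> {1..}" b a 2 "(pair, 1)"])
    show "a p \<le> 2 * b p" if "p \<in> X \<times> {1..}" for p
      using that gap_le_sigma[OF _ _ _ greedy_set, of "fst p" "snd p"] by (auto simp: a_def b_def)
  qed (use b_nonneg a_pair pair_in_X in auto)
  have "l1.semi_greedy_bound X x x' N \<longleftrightarrow> (\<forall>p\<in>X \<times> {1..}. a p \<le> N * b p)" for N
  proof -
    have "(\<exists>z\<in>l1.span (x ` l1.greedy_set x' m v). norm (v - z) \<le> N * l1.sigma X x x' m v) \<longleftrightarrow>
        a (v, m) \<le> N * b (v, m)" if "v \<in> X" "1 \<le> m" for v m
      unfolding a_def b_def fst_conv snd_conv
      using greedy_set_facts[OF that(1), of m] that by (intro gap_attained_span) auto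
    moreover have "N > 0" if "\<forall>p\<in>X \<times> {1..}. a p \<le> N * b p"
    proof (rule ccontr)
      assume "\<not> N > 0"
      then have "N * b (pair, 1) \<le> 0"
        using b_nonneg[of "(pair, 1)"] pair_in_X by (simp add: mult_nonpos_nonneg)
      with that a_pair pair_in_X show False
        by force
    qed
    ultimately show ?thesis
      unfolding l1.semi_greedy_bound_def by auto
  qed
  then have "l1.semi_greedy_bound X x x' = (\<lambda>N. \<forall>p\<in>X \<times> {1..}. a p \<le> N * b p)"
    by (intro ext)
  with M show ?thesis
    unfolding l1.semi_greedy_constant_def by (intro exI[of _ M]) simp
qed

end

section \<open>A semi-greedy basis with large almost greedy constant\<close>

theorem mainTheorem4:
  fixes \<alpha> :: real
    and x :: "nat \<Rightarrow> 'k::{real_normed_field, euclidean_space} l1"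
    and X :: "'k l1 set"
    and x' :: "nat \<Rightarrow> 'k l1 \<Rightarrow> 'k"
  assumes \<alpha>: "\<alpha> > 0"
    and x: "\<And>i. i \<ge> 2 \<Longrightarrow> x i = l1_unit i + l1_scale (of_real (2 * (\<alpha> + 1) * (- 1) ^ i)) (l1_unit 1)"
    and X: "X = closure (l1.span (x ` {2..}))"
    and x': "\<And>i. i \<ge> 2 \<Longrightarrow> x' i = restrict (l1_coord i) X"
  shows
    \<comment> \<open>(a)\<close>
    "(l1.basic_sequence (\<lambda>k. x (k + 2)) \<and>
      l1.equivalent_sequences (\<lambda>k. x (k + 2)) (\<lambda>k. l1_unit (k + 1)) \<and>
      (\<exists>K\<^sub>d. l1.democracy_constant x K\<^sub>d \<and> K\<^sub>d > \<alpha> + 1)) \<and>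
    \<comment> \<open>(b)\<close>
     (l1.markushevich_basis X x x' \<and>
      l1.almost_greedy X x x' \<and>
      (\<exists>K. l1.almost_greedy_constant X x x' K \<and> K > \<alpha>) \<and>
      (\<exists>K. l1.first_quasi_greedy_constant X x x' K \<and> K > \<alpha>) \<and>
      (\<exists>K. l1.second_quasi_greedy_constant X x x' K \<and> K > \<alpha>)) \<and>
    \<comment> \<open>(c)\<close>
     (\<forall>\<tau> M. 0 < \<tau> \<and> \<tau> < 1 \<and> l1.WAG X x x' \<tau> M \<longrightarrow> M > \<tau> * sqrt (\<alpha> + 1)) \<and>
    \<comment> \<open>(d)\<close>
     (l1.markushevich_basis X x x' \<and>
      l1.semi_greedy X x x' \<and>
      (\<exists>K\<^sub>s. l1.semi_greedy_constant X x x' K\<^sub>s \<and> K\<^sub>s \<le> 4) \<and>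
      (\<forall>\<tau> v m W. 0 < \<tau> \<and> \<tau> \<le> 1 \<and> v \<in> X \<and> 1 \<le> m \<and> l1.weak_thresholding_set x' \<tau> v m W \<longrightarrow>
         (\<exists>b. norm (v - (\<Sum>i\<in>W. l1_scale (b i) (x i))) \<le> 4 * inverse \<tau> * l1.sigma X x x' m v)))"
proof -
  interpret T: tilted_units "2 * (\<alpha> + 1)" x X x'
    by unfold_locales (use \<alpha> x X x' in auto)
  have bound: "(1 + 2 * (\<alpha> + 1)) / 2 = \<alpha> + 3 / 2"
    by simp
  have "l1.almost_greedy X x x'" "l1.semi_greedy X x x'"
    using T.almost_greedy T.semi_greedy T.bounded_functionals
    by (auto simp: l1.almost_greedy_def l1.almost_greedy_constant_def l1.semi_greedy_def
        l1.semi_greedy_constant_def is_minimum_def)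
  moreover have "\<exists>K. l1.democracy_constant x K \<and> K > \<alpha> + 1"
    using T.democracy unfolding bound by force
  moreover have "\<exists>K. l1.almost_greedy_constant X x x' K \<and> K > \<alpha>"
    using T.almost_greedy unfolding bound by force
  moreover have "\<exists>K. l1.first_quasi_greedy_constant X x x' K \<and> K > \<alpha>"
    using T.first_quasi_greedy unfolding bound by force
  moreover have "\<exists>K. l1.second_quasi_greedy_constant X x x' K \<and> K > \<alpha>"
    using T.second_quasi_greedy unfolding bound by force
  moreover have "M > \<tau> * sqrt (\<alpha> + 1)" if "0 < \<tau>" "\<tau> < 1" "l1.WAG X x x' \<tau> M" for \<tau> M
  proof -
    have "\<tau> * sqrt (\<alpha> + 1) \<le> 1 * sqrt (\<alpha> + 1)"
      using that \<alpha> by (intro mult_right_mono) auto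
    also have "\<dots> \<le> \<alpha> + 1"
      using \<alpha> by (simp add: real_le_lsqrt power2_eq_square)
    also have "\<dots> < M"
      using T.WAG_lower_bound[OF that(1,3)] unfolding bound by simp
    finally show ?thesis .
  qed
  moreover have "\<exists>K. l1.semi_greedy_constant X x x' K \<and> K \<le> 4"
    using T.semi_greedy by force
  ultimately show ?thesis
    using T.basic T.equivalent T.markushevich T.thresholding_approximation by blast
qed

end
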